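(* Let $n,p\ge 1$ be integers, $\lambda=(\lambda_1,\dots,\lambda_p)\in\mathbb R^p$, $\mu\in\mathbb R$ and $\delta=\mu-\sum_{i=1}^p\lambda_i$. For $i,j\in\{1,\dots,n\}$ consider the vector fields on $\mathbb R^n$ $$e_{ij}=-x^j\partial_i,\quad e_{ij}^*=e_{ji}\ (i\ne j);\qquad e_{ii}=-x^i\partial_i-\sum_k x^k\partial_k,\quad e_{ii}^*=-x^i\partial_i;$$ $$e_i=-\partial_i,\quad e_i^*=\epsilon^i;\qquad \epsilon^i=x^i\sum_k x^k\partial_k,\quad \epsilon^{i*}=e_i .$$ Then the Casimir operator $$\mathcal C^{op}=\sum_{i\neq j}L_{e_{ij}}\circ L_{e_{ij}^*}+\sum_{i}\left(L_{e_{ii}}\circ L_{e_{ii}^*}+L_{e_{i}}\circ L_{e_{i}^*}+L_{\epsilon^i}\circ L_{\epsilon^{i*}}\right)$$ of $sl_{n+1}$ acting on $\mathcal M^p_{\mathit{diff}}(\lambda,\mu)$ equals (operators being identified with their polynomial forms) the sum $\mathcal C^{op}=\mathcal C^t+N_{\mathcal C}$, where $$\mathcal C^t=n(n+1)\delta(\delta-1)\,\mathrm{id}+2(n+1)(1-\delta)\sum_k E_{\xi^k}+\sum_{k,l}\sum_{i,j}\xi^k_i\xi^l_jD_{\xi^k_j}D_{\xi^l_i}+\sum_{k,l}\sum_{i,j}\xi^k_i\xi^l_jD_{\xi^k_i}D_{\xi^l_j}$$ (with $k,l$ ranging over $\{1,\dots,p\}$ and $i,j$ over $\{1,\dots,n\}$)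 is the Casimir operator of $sl_{n+1}$ acting on $\mathcal S^{(p)}_\delta$ (i.e. the same sum of compositions of Lie derivatives, computed with the Lie derivatives of $\mathcal S^{(p)}_\delta$), and $$N_{\mathcal C}=2\sum_{k=1}^p\left(E_{\xi^k}+(n+1)\lambda_k\right)(\eta D_{\xi^k}).$$
   Context: Everything is smooth; $x^1,\dots,x^n$ are the coordinates of $\mathbb R^n$ and $\partial_i=\partial/\partial x^i$ (also the $i$-th unit vector field). Densities: for $\lambda\in\mathbb R$, densities of weight $\lambda$ on $\mathbb R^n$ are sections of the trivial line bundle $\Delta^\lambda(\mathbb R^n)$; they are identified with functions $\phi$ on which a vector field $X$ acts by $L_X\phi=\sum_iX^i\partial_i\phi+\lambda\left(\sum_i\partial_iX^i\right)\phi$. Multidifferential operators: $\mathcal M^p_{\mathit{diff}}(\lambda,\mu)$ is the space of $p$-linear multidifferential operators $T:(f_1,\dots,f_p)\mapsto\sum A_{a^1,\dots,a^p}D^{a^1}f_1\cdots D^{a^p}f_p$ (finite sums; the $a^j$ are multi-indices and $D^{a}$ the corresponding iterated partial derivative) transforming densities of weights $\lambda_1,\dots,\lambda_p$ into a density of weight $\mu$; the coefficients $A$ are densities of weight $\delta$. It is a module over vector fields via $L_XT=L_X\circ T-\sum_{i=1}^pT(\dots,L_X\cdot,\dots)$ ($L_X$ in the $i$-th argument). Symbols: $\mathcal S^{(p)}_\delta=\bigoplus_{i_1,\dots,i_p\ge0}\Gamma(\vee^{i_1}(T\mathbb R^n)\otimes\cdots\otimes\vee^{i_p}(T\mathbb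 R^n)\otimes\Delta^\delta(\mathbb R^n))$ ($\vee$ denotes the symmetric power), with its natural Lie derivative. Its elements are viewed as polynomials $P$ in covariant variables $\xi^1,\dots,\xi^p\in\mathbb R^{n*}$, with $\delta$-densities as coefficients; then $L_XP=\sum_iX^i\partial_iP-\sum_{k}\sum_{i,j}(\partial_jX^i)\,\xi^k_iD_{\xi^k_j}P+\delta\left(\sum_i\partial_iX^i\right)P$. The polynomial form of $T$ is $\sum A_{a^1,\dots,a^p}(\xi^1)^{a^1}\cdots(\xi^p)^{a^p}\in\mathcal S^{(p)}_\delta$; this gives a linear bijection between $\mathcal M^p_{\mathit{diff}}(\lambda,\mu)$ and $\mathcal S^{(p)}_\delta$. Notation: $D_{\xi^k_i}$ is the partial derivative with respect to the variable $\xi^k_i$, $E_{\xi^k}=\sum_i\xi^k_iD_{\xi^k_i}$, and $\eta$ denotes the partial derivatives of the coefficients, so $(\eta D_{\xi^k})P=\sum_i\partial_iD_{\xi^k_i}P$. $sl_{n+1}$ is the Lie algebra of polynomial vector fields on $\mathbb R^n$ spanned by $\partial_i$, $x^j\partial_i$ and $x^j\sum_ix^i\partial_i$ ($1\le i,j\le n$), isomorphic to $sl(n+1,\mathbb R)$. The families $(e_{ij},e_{ii},e_i,\epsilon^i)$ and $(e_{ij}^*,e_{ii}^*,e_i^*,\epsilon^{i*})$ are bases of it, dual to each other for a multiple of its Killing form. *)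

theory Defs
  imports "HOL-Analysis.Analysis" "HOL-Library.Function_Algebras"
begin

text \<open>
  \<open>\<real>\<^sup>n\<close> is \<open>real^'n\<close>, and the \<open>p\<close> arguments of an operator are indexed by the finite type \<open>'p\<close>.
  Functions are added pointwise (\<open>HOL-Library.Function_Algebras\<close>).
\<close>

definition partial :: "'n::finite \<Rightarrow> (real^'n \<Rightarrow> real) \<Rightarrow> real^'n \<Rightarrow> real" where
  "partial i f x = frechet_derivative f (at x) (axis i 1)"

primrec partials :: "'n::finite list \<Rightarrow> (real^'n \<Rightarrow> real) \<Rightarrow> real^'n \<Rightarrow> real" where
  "partials [] f = f"
| "partials (i # is) f = partial i (partials is f)"

definition smooth :: "(real^'n::finite \<Rightarrow> real) \<Rightarrow> bool" where
  "smooth f \<longleftrightarrow> (\<forall>is x. partials is f differentiable (at x))"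

text \<open>
  The index type carries no order, so the derivative \<open>D\<^sup>a\<close> is taken along an arbitrary list
  containing each \<open>i\<close> exactly \<open>a i\<close> times; on smooth functions all such lists give the same result.
\<close>

definition multi_partial :: "('n::finite \<Rightarrow> nat) \<Rightarrow> (real^'n \<Rightarrow> real) \<Rightarrow> real^'n \<Rightarrow> real" where
  "multi_partial a = partials (SOME is. \<forall>i. count_list is i = a i)"

definition divergence :: "(real^'n::finite \<Rightarrow> real^'n) \<Rightarrow> real^'n \<Rightarrow> real" where
  "divergence X x = (\<Sum>i\<in>UNIV. partial i (\<lambda>y. X y $ i) x)"

definition lie_density ::
  "real \<Rightarrow> (real^'n::finite \<Rightarrow> real^'n) \<Rightarrow> (real^'n \<Rightarrow> real) \<Rightarrow> real^'n \<Rightarrow> real" where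
  "lie_density w X \<phi> x = (\<Sum>i\<in>UNIV. X x $ i * partial i \<phi> x) + w * divergence X x * \<phi> x"


subsection \<open>Multidifferential operators\<close>

type_synonym ('n, 'p) multiop = "('p \<Rightarrow> real^'n \<Rightarrow> real) \<Rightarrow> real^'n \<Rightarrow> real"

text \<open>
  Operators are given the value 0 on tuples that are not smooth, so that equality of HOL functions
  is equality of operators on smooth densities.  A multi-index family \<open>(a\<^sup>1, \<dots>, a\<^sup>p)\<close> is a function
  \<open>a :: 'p \<Rightarrow> 'n \<Rightarrow> nat\<close>; \<open>I\<close> is the finite set of families occurring in the sum.
\<close>

definition multidiff_of ::
  "('p::finite \<Rightarrow> 'n::finite \<Rightarrow> nat) set \<Rightarrow> (('p \<Rightarrow> 'n \<Rightarrow> nat) \<Rightarrow> real^'n \<Rightarrow> real) \<Rightarrow> ('n, 'p) multiop" where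
  "multidiff_of I A f =
    (if \<forall>k. smooth (f k)
     then (\<lambda>x. \<Sum>a\<in>I. A a x * (\<Prod>k\<in>UNIV. multi_partial (a k) (f k) x))
     else 0)"

text \<open>The weights do not affect the underlying space, only the action of vector fields on it.\<close>

definition multidiff_ops :: "('n::finite, 'p::finite) multiop set" where
  "multidiff_ops = {multidiff_of I A | I A. finite I \<and> (\<forall>a\<in>I. smooth (A a))}"

definition lie_op ::
  "real^'p::finite \<Rightarrow> real \<Rightarrow> (real^'n::finite \<Rightarrow> real^'n) \<Rightarrow> ('n, 'p) multiop \<Rightarrow> ('n, 'p) multiop" where
  "lie_op lam \<mu> X T f =
    (if \<forall>k. smooth (f k)
     then lie_density \<mu> X (T f) - (\<Sum>k\<in>UNIV. T (f(k := lie_density (lam $ k) X (f k))))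
     else 0)"


subsection \<open>Symbols\<close>

text \<open>
  A symbol is the function \<open>P x \<xi>\<close>, polynomial in \<open>\<xi> = (\<xi>\<^sup>1, \<dots>, \<xi>\<^sup>p)\<close> with smooth coefficients in \<open>x\<close>;
  the variable \<open>\<xi>\<^sup>k\<^sub>i\<close> is \<open>\<xi> $ k $ i\<close>.
\<close>

type_synonym ('n, 'p) symb = "real^'n \<Rightarrow> real^'n^'p \<Rightarrow> real"

definition symbol_of ::
  "('p::finite \<Rightarrow> 'n::finite \<Rightarrow> nat) set \<Rightarrow> (('p \<Rightarrow> 'n \<Rightarrow> nat) \<Rightarrow> real^'n \<Rightarrow> real) \<Rightarrow> ('n, 'p) symb" where
  "symbol_of I A x \<xi> = (\<Sum>a\<in>I. A a x * (\<Prod>k\<in>UNIV. \<Prod>i\<in>UNIV. (\<xi> $ k $ i) ^ a k i))"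

definition symbols :: "('n::finite, 'p::finite) symb set" where
  "symbols = {symbol_of I A | I A. finite I \<and> (\<forall>a\<in>I. smooth (A a))}"

definition polynomial_form :: "('n::finite, 'p::finite) multiop \<Rightarrow> ('n, 'p) symb" where
  "polynomial_form T = (THE P. \<exists>I A. finite I \<and> (\<forall>a\<in>I. smooth (A a)) \<and>
      T = multidiff_of I A \<and> P = symbol_of I A)"

definition D_xi :: "'p::finite \<Rightarrow> 'n::finite \<Rightarrow> ('n, 'p) symb \<Rightarrow> ('n, 'p) symb" where
  "D_xi k i P x \<xi> = frechet_derivative (P x) (at \<xi>) (axis k (axis i 1))"

definition euler_xi :: "'p::finite \<Rightarrow> ('n::finite, 'p) symb \<Rightarrow> ('n, 'p) symb" where
  "euler_xi k P x \<xi> = (\<Sum>i\<in>UNIV. \<xi> $ k $ i * D_xi k i P x \<xi>)"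

definition eta_D :: "'p::finite \<Rightarrow> ('n::finite, 'p) symb \<Rightarrow> ('n, 'p) symb" where
  "eta_D k P x \<xi> = (\<Sum>i\<in>UNIV. partial i (\<lambda>y. D_xi k i P y \<xi>) x)"

definition lie_symbol ::
  "real \<Rightarrow> (real^'n::finite \<Rightarrow> real^'n) \<Rightarrow> ('n, 'p::finite) symb \<Rightarrow> ('n, 'p) symb" where
  "lie_symbol \<delta> X P x \<xi> =
    (\<Sum>i\<in>UNIV. X x $ i * partial i (\<lambda>y. P y \<xi>) x)
    - (\<Sum>k\<in>UNIV. \<Sum>i\<in>UNIV. \<Sum>j\<in>UNIV.
        partial j (\<lambda>y. X y $ i) x * \<xi> $ k $ i * D_xi k j P x \<xi>)
    + \<delta> * divergence X x * P x \<xi>"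


subsection \<open>Casimir operators\<close>

text \<open>
  The vector field \<open>\<partial>\<^sub>i\<close> is the constant \<open>axis i 1\<close>, and \<open>\<Sum>\<^sub>k x\<^sup>k \<partial>\<^sub>k\<close> is the identity \<open>\<lambda>x. x\<close>.
\<close>

definition e_mat :: "'n::finite \<Rightarrow> 'n \<Rightarrow> real^'n \<Rightarrow> real^'n" where
  "e_mat i j x = (if i = j then - (x $ i) *\<^sub>R axis i 1 - x else - (x $ j) *\<^sub>R axis i 1)"

definition e_mat_dual :: "'n::finite \<Rightarrow> 'n \<Rightarrow> real^'n \<Rightarrow> real^'n" where
  "e_mat_dual i j = (if i = j then (\<lambda>x. - (x $ i) *\<^sub>R axis i 1) else e_mat j i)"

definition e_vec :: "'n::finite \<Rightarrow> real^'n \<Rightarrow> real^'n" where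
  "e_vec i x = - axis i 1"

definition eps_vec :: "'n::finite \<Rightarrow> real^'n \<Rightarrow> real^'n" where
  "eps_vec i x = (x $ i) *\<^sub>R x"

definition e_vec_dual :: "'n::finite \<Rightarrow> real^'n \<Rightarrow> real^'n" where
  "e_vec_dual i = eps_vec i"

definition eps_vec_dual :: "'n::finite \<Rightarrow> real^'n \<Rightarrow> real^'n" where
  "eps_vec_dual i = e_vec i"

definition casimir :: "((real^'n::finite \<Rightarrow> real^'n) \<Rightarrow> 'v \<Rightarrow> 'v) \<Rightarrow> 'v \<Rightarrow> 'v::ab_group_add" where
  "casimir L v =
    (\<Sum>(i, j)\<in>{(i, j). i \<noteq> j}. L (e_mat i j) (L (e_mat_dual i j) v))
    + (\<Sum>i\<in>UNIV. L (e_mat i i) (L (e_mat_dual i i) v)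
        + L (e_vec i) (L (e_vec_dual i) v)
        + L (eps_vec i) (L (eps_vec_dual i) v))"

definition C_t :: "real \<Rightarrow> ('n::finite, 'p::finite) symb \<Rightarrow> ('n, 'p) symb" where
  "C_t \<delta> P x \<xi> =
    (let n = real CARD('n) in
      n * (n + 1) * \<delta> * (\<delta> - 1) * P x \<xi>
      + 2 * (n + 1) * (1 - \<delta>) * (\<Sum>k\<in>UNIV. euler_xi k P x \<xi>)
      + (\<Sum>k\<in>UNIV. \<Sum>l\<in>UNIV. \<Sum>i\<in>UNIV. \<Sum>j\<in>UNIV.
          \<xi> $ k $ i * \<xi> $ l $ j * D_xi k j (D_xi l i P) x \<xi>)
      + (\<Sum>k\<in>UNIV. \<Sum>l\<in>UNIV. \<Sum>i\<in>UNIV. \<Sum>j\<in>UNIV.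
          \<xi> $ k $ i * \<xi> $ l $ j * D_xi k i (D_xi l j P) x \<xi>))"

definition N_C :: "real^'p::finite \<Rightarrow> ('n::finite, 'p) symb \<Rightarrow> ('n, 'p) symb" where
  "N_C lam P x \<xi> =
    2 * (\<Sum>k\<in>UNIV. euler_xi k (eta_D k P) x \<xi>
          + (real CARD('n) + 1) * lam $ k * eta_D k P x \<xi>)"

end

theory Submission
  imports Defs
begin

text \<open>
  The proof compares operators with symbols through operations whose effect on both sides is known.
  The relation \<open>has_symbol T P\<close> expresses that \<open>P\<close> is the polynomial form of \<open>T\<close>; it is functional in \<open>T\<close>
  because \<open>T\<close> applied to exponentials \<open>exp(\<xi>\<^sup>k \<bullet> y)\<close> returns \<open>P x \<xi>\<close> times a nonvanishing factor
  (\<open>has_symbol_exp\<close>).  Under this relation, multiplication of the result by a function \<open>g\<close> corresponds to \<open>g\<close>,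
  differentiation \<open>\<partial>\<^sub>i\<close> of the result to \<open>\<partial>\<^sub>i + \<Sum>\<^sub>k \<xi>\<^sup>k\<^sub>i\<close>, and precomposition in the \<open>k\<close>-th argument with \<open>\<partial>\<^sub>i\<close>
  or with multiplication by \<open>x\<^sup>j\<close> to \<open>\<xi>\<^sup>k\<^sub>i\<close> or \<open>x\<^sup>j + D\<^bsub>\<xi>\<^sup>k\<^sub>j\<^esub>\<close> (\<open>has_symbol_mult\<close>, \<open>has_symbol_partial\<close>,
  \<open>has_symbol_slot_partial\<close>, \<open>has_symbol_slot_coord\<close>).

  The Lie derivative of operators along a polynomial vector field is composed of these operations.  Along
  an affine field it becomes the Lie derivative of symbols.  Along the quadratic field \<open>\<epsilon>\<^sup>i\<close> a second-order
  term of the Leibniz rule and the derivative of the divergence remain: the Lie derivative of symbols is diminished by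
  \<open>\<Sum>\<^sub>k (E\<^bsub>\<xi>\<^sup>k\<^esub> + (n + 1) \<lambda>\<^sub>k) D\<^bsub>\<xi>\<^sup>k\<^sub>i\<^esub>\<close> (\<open>has_symbol_lie_op_eps_vec\<close>).  In the Casimir sum \<open>\<epsilon>\<^sup>i\<close> is multiplied by
  \<open>e\<^sub>i = - \<partial>\<^sub>i\<close> from either side, and \<open>\<partial>\<^sub>i\<close> commutes with the extra term, so the two Casimir operators
  differ by twice the sum of its products with \<open>\<partial>\<^sub>i\<close>, which is \<open>N_C\<close>.

  On symbols, the Lie derivative along \<open>x\<^sup>j \<partial>\<^sub>i\<close> is \<open>x\<^sup>j \<partial>\<^sub>i - B\<^sub>i\<^sub>j\<close>, where \<open>B\<^sub>i\<^sub>j\<close> acts on the fibres by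
  \<open>\<Sum>\<^sub>k \<xi>\<^sup>k\<^sub>i D\<^bsub>\<xi>\<^sup>k\<^sub>j\<^esub>\<close>, less \<open>\<delta>\<close> if \<open>i = j\<close>, and commutes with coordinates and their derivatives.  These
  commutation rules suffice to see that the Casimir operator equals
  \<open>\<Sum>\<^sub>i\<^sub>j B\<^sub>i\<^sub>j B\<^sub>j\<^sub>i + (\<Sum>\<^sub>i B\<^sub>i\<^sub>i)\<^sup>2 + (n + 1) \<Sum>\<^sub>i B\<^sub>i\<^sub>i\<close> (\<open>casimir_algebra\<close>), as it has to commute with translations
  and cannot depend on \<open>x\<close>.  Moving all derivatives \<open>D\<^sub>\<xi>\<close> to the right gives \<open>C_t\<close> (\<open>casimir_lie_symbol\<close>).
\<close>

section \<open>Smooth functions and the symmetry of second derivatives\<close>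

lemma partial_eq: "(f has_derivative f') (at x) \<Longrightarrow> partial i f x = f' (axis i 1)"
  unfolding partial_def using frechet_derivative_at by metis

lemma partial_const [simp]: "partial i (\<lambda>y. c) x = 0"
  by (simp add: partial_def)

lemma partial_add:
  assumes "f differentiable (at x)" "g differentiable (at x)"
  shows "partial i (\<lambda>y. f y + g y) x = partial i f x + partial i g x"
proof -
  obtain f' g' where "(f has_derivative f') (at x)" "(g has_derivative g') (at x)"
    using assms unfolding differentiable_def by blast
  then show ?thesis using partial_eq[OF has_derivative_add] by (simp add: partial_eq)
qed

lemma partial_mult:
  assumes "f differentiable (at x)" "g differentiable (at x)"
  shows "partial i (\<lambda>y. f y * g y) x = f x * partial i g x + partial i f x * g x"
proof -
  obtain f' g' where "(f has_derivative f') (at x)" "(g has_derivative g') (at x)"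
    using assms unfolding differentiable_def by blast
  then show ?thesis using partial_eq[OF has_derivative_mult] by (simp add: partial_eq)
qed

lemma partial_cmult:
  "f differentiable (at x) \<Longrightarrow> partial i (\<lambda>y. c * f y) x = c * partial i f x"
  by (simp add: partial_mult)

lemma partial_sum:
  assumes "\<And>a. a \<in> I \<Longrightarrow> f a differentiable (at x)"
  shows "partial i (\<lambda>y. \<Sum>a\<in>I. f a y) x = (\<Sum>a\<in>I. partial i (f a) x)"
  using assms
proof (induction I rule: infinite_finite_induct)
  case (insert a I)
  then show ?case by (simp add: partial_add)
qed simp_all

lemma partial_coord [simp]: "partial i (\<lambda>y. y $ j) x = (if i = j then 1 else 0)"
proof -
  have "((\<lambda>y::real^'a. y $ j) has_derivative (\<lambda>y. y $ j)) (at x)"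
    by (intro bounded_linear_imp_has_derivative bounded_linear_vec_nth)
  then show ?thesis by (simp add: partial_eq axis_def eq_commute)
qed

lemma differentiable_coord [simp]: "(\<lambda>y::real^'n::finite. y $ j) differentiable (at x)"
  by (intro bounded_linear_imp_differentiable bounded_linear_vec_nth)

lemma smooth_differentiable: "smooth f \<Longrightarrow> f differentiable (at x)"
  unfolding smooth_def by (metis partials.simps(1))

lemma partials_append: "partials (is @ js) f = partials is (partials js f)"
  by (induction "is") simp_all

lemma smooth_partials: "smooth f \<Longrightarrow> smooth (partials is f)"
  by (simp add: smooth_def flip: partials_append)

lemma smooth_partial: "smooth f \<Longrightarrow> smooth (partial i f)"
  using smooth_partials[of f "[i]"] by simp

text \<open>
  \<open>smooth\<close> speaks of all iterated derivatives at once.  It is the largest class of differentiable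
  functions closed under the \<open>partial i\<close>, so smoothness can be shown by exhibiting any such class.
\<close>

lemma smooth_coinduct:
  assumes "Q f" and diff: "\<And>g x. Q g \<Longrightarrow> g differentiable (at x)"
    and step: "\<And>g i. Q g \<Longrightarrow> Q (partial i g)"
  shows "smooth f"
proof -
  have "Q (partials is f)" for "is"
    using \<open>Q f\<close> by (induction "is") (auto intro: step)
  then show ?thesis unfolding smooth_def by (blast intro: diff)
qed

text \<open>
  The Leibniz rule turns a product into a sum of two products, so products alone are not closed under
  differentiation; finite sums of products are, and this is the class that makes products of smooth
  functions smooth by coinduction.
\<close>

inductive product_sum :: "(real^'n::finite \<Rightarrow> real) \<Rightarrow> bool" where
  prod: "smooth f \<Longrightarrow> smooth g \<Longrightarrow> product_sum (\<lambda>y. f y * g y)"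
| add: "product_sum u \<Longrightarrow> product_sum v \<Longrightarrow> product_sum (\<lambda>y. u y + v y)"

lemma product_sum_differentiable: "product_sum u \<Longrightarrow> u differentiable (at x)"
  by (induction rule: product_sum.induct) (auto intro: derivative_intros smooth_differentiable)

lemma product_sum_partial: "product_sum u \<Longrightarrow> product_sum (partial i u)"
proof (induction rule: product_sum.induct)
  case (prod f g)
  have "partial i (\<lambda>y. f y * g y) = (\<lambda>y. f y * partial i g y + partial i f y * g y)"
    using prod by (auto intro!: partial_mult smooth_differentiable)
  then show ?case using prod by (auto intro!: product_sum.intros smooth_partial)
next
  case (add u v)
  have "partial i (\<lambda>y. u y + v y) = (\<lambda>y. partial i u y + partial i v y)"
    using add by (auto intro!: partial_add product_sum_differentiable)
  then show ?case using add by (auto intro!: product_sum.intros)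
qed

lemma smooth_product_sum: "product_sum u \<Longrightarrow> smooth u"
  by (rule smooth_coinduct[where Q = product_sum])
    (auto intro: product_sum_differentiable product_sum_partial)

lemma smooth_mult: "smooth f \<Longrightarrow> smooth g \<Longrightarrow> smooth (\<lambda>y. f y * g y)"
  by (rule smooth_product_sum[OF product_sum.prod])

lemma smooth_const [simp]: "smooth (\<lambda>y. c)"
  by (rule smooth_coinduct[where Q = "\<lambda>f. \<exists>c. f = (\<lambda>y. c)"]) (auto simp: fun_eq_iff[of "partial _ _"])

lemma smooth_add: "smooth f \<Longrightarrow> smooth g \<Longrightarrow> smooth (\<lambda>y. f y + g y)"
  using smooth_product_sum[OF product_sum.add[OF product_sum.prod[of f "\<lambda>y. 1"]
        product_sum.prod[of g "\<lambda>y. 1"]]] by simp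

lemma smooth_sum: "(\<And>a. a \<in> I \<Longrightarrow> smooth (f a)) \<Longrightarrow> smooth (\<lambda>y. \<Sum>a\<in>I. f a y)"
  by (induction I rule: infinite_finite_induct) (auto intro: smooth_add)

lemma smooth_prod: "(\<And>a. a \<in> I \<Longrightarrow> smooth (f a)) \<Longrightarrow> smooth (\<lambda>y. \<Prod>a\<in>I. f a y)"
  by (induction I rule: infinite_finite_induct) (auto intro: smooth_mult)

lemma smooth_coord [simp]: "smooth (\<lambda>y::real^'n::finite. y $ j)"
proof -
  have "partial i (\<lambda>y::real^'n. y $ j) = (\<lambda>y. if i = j then 1 else 0)" for i
    by (simp add: fun_eq_iff)
  then show ?thesis
    by (intro smooth_coinduct[where Q = "\<lambda>f. f = (\<lambda>y. y $ j) \<or> smooth f"])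
      (auto intro: smooth_differentiable smooth_partial)
qed

lemmas smooth_intros = smooth_mult smooth_add smooth_sum smooth_prod
  smooth_partial

lemma partial_exp_inner:
  "partial i (\<lambda>y. exp (\<xi> \<bullet> y)) x = \<xi> $ i * exp (\<xi> \<bullet> x)"
proof -
  have "((\<lambda>y. exp (\<xi> \<bullet> y)) has_derivative (\<lambda>h. exp (\<xi> \<bullet> x) * (\<xi> \<bullet> h))) (at x)"
    by (auto intro!: derivative_eq_intros)
  then show ?thesis by (simp add: partial_eq inner_axis)
qed

lemma differentiable_exp_inner: "(\<lambda>y::real^'n::finite. exp (\<xi> \<bullet> y)) differentiable (at x)"
proof -
  have "((\<lambda>y. exp (\<xi> \<bullet> y)) has_derivative (\<lambda>h. exp (\<xi> \<bullet> x) * (\<xi> \<bullet> h))) (at x)"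
    by (auto intro!: derivative_eq_intros)
  then show ?thesis by (auto simp: differentiable_def)
qed

lemma smooth_exp_inner: "smooth (\<lambda>y::real^'n::finite. exp (\<xi> \<bullet> y))"
proof (rule smooth_coinduct[where Q = "\<lambda>f. \<exists>c. f = (\<lambda>y. c * exp (\<xi> \<bullet> y))"])
  show "\<exists>c. (\<lambda>y. exp (\<xi> \<bullet> y)) = (\<lambda>y. c * exp (\<xi> \<bullet> y))" by (rule exI[of _ 1]) simp
next
  fix f :: "real^'n \<Rightarrow> real" and i
  assume "\<exists>c. f = (\<lambda>y. c * exp (\<xi> \<bullet> y))"
  then obtain c where f: "f = (\<lambda>y. c * exp (\<xi> \<bullet> y))" by blast
  show "\<exists>c. partial i f = (\<lambda>y. c * exp (\<xi> \<bullet> y))"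
    by (rule exI[of _ "c * \<xi> $ i"])
      (simp add: f fun_eq_iff partial_cmult differentiable_exp_inner partial_exp_inner)
qed (auto intro!: derivative_intros differentiable_exp_inner)

lemma DERIV_along_axis:
  assumes "smooth f"
  shows "((\<lambda>s. f (x + s *\<^sub>R axis i 1)) has_real_derivative partial i f (x + s *\<^sub>R axis i 1)) (at s)"
proof -
  let ?y = "x + s *\<^sub>R axis i 1"
  let ?f' = "frechet_derivative f (at ?y)"
  have f': "(f has_derivative ?f') (at ?y)"
    using smooth_differentiable[OF assms] frechet_derivative_works by blast
  have "((\<lambda>s. x + s *\<^sub>R axis i 1) has_derivative (\<lambda>h. h *\<^sub>R axis i 1)) (at s)"
    by (auto intro!: derivative_eq_intros)
  from diff_chain_at[OF this f']
  have "((\<lambda>s. f (x + s *\<^sub>R axis i 1)) has_derivative (\<lambda>h. ?f' (h *\<^sub>R axis i 1))) (at s)"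
    by (simp add: o_def)
  moreover have "?f' (h *\<^sub>R axis i 1) = partial i f ?y * h" for h
    using linear_cmul[OF has_derivative_linear[OF f']] by (simp add: partial_def)
  ultimately show ?thesis by (simp add: has_field_derivative_def)
qed

text \<open>
  The classical approach to the symmetry of second derivatives: the second difference over the square
  with corners \<open>x\<close>, \<open>x + h e\<^sub>i\<close>, \<open>x + h e\<^sub>j\<close>, \<open>x + h e\<^sub>i + h e\<^sub>j\<close> is symmetric in \<open>i\<close> and \<open>j\<close>, and
  two applications of the mean value theorem express it by a second derivative at a point of the square.
\<close>

lemma mixed_difference:
  fixes f :: "real^'n::finite \<Rightarrow> real"
  assumes f: "smooth f" and h: "h > 0"
  shows "\<exists>s t. 0 < s \<and> s < h \<and> 0 < t \<and> t < h \<and>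
    f (x + h *\<^sub>R axis i 1 + h *\<^sub>R axis j 1) - f (x + h *\<^sub>R axis i 1) - f (x + h *\<^sub>R axis j 1) + f x
      = h * h * partial j (partial i f) (x + s *\<^sub>R axis i 1 + t *\<^sub>R axis j 1)"
proof -
  let ?g = "\<lambda>s. f ((x + h *\<^sub>R axis j 1) + s *\<^sub>R axis i 1) - f (x + s *\<^sub>R axis i 1)"
  let ?g' = "\<lambda>s. partial i f ((x + h *\<^sub>R axis j 1) + s *\<^sub>R axis i 1) - partial i f (x + s *\<^sub>R axis i 1)"
  have "(?g has_real_derivative ?g' s) (at s)" for s
    by (intro derivative_intros DERIV_along_axis f)
  then obtain s where s: "0 < s" "s < h" "?g h - ?g 0 = h * ?g' s"
    using MVT2[of 0 h ?g ?g'] h by auto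
  let ?k = "\<lambda>t. partial i f ((x + s *\<^sub>R axis i 1) + t *\<^sub>R axis j 1)"
  let ?k' = "\<lambda>t. partial j (partial i f) ((x + s *\<^sub>R axis i 1) + t *\<^sub>R axis j 1)"
  have "(?k has_real_derivative ?k' t) (at t)" for t
    by (intro derivative_intros DERIV_along_axis smooth_partial f)
  then obtain t where t: "0 < t" "t < h" "?k h - ?k 0 = h * ?k' t"
    using MVT2[of 0 h ?k ?k'] h by auto
  have "?g' s = ?k h - ?k 0" by (simp add: add_ac)
  then have "?g h - ?g 0 = h * (h * ?k' t)" using s t by metis
  moreover have "?g h - ?g 0 = f (x + h *\<^sub>R axis i 1 + h *\<^sub>R axis j 1)
      - f (x + h *\<^sub>R axis i 1) - f (x + h *\<^sub>R axis j 1) + f x"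
    by (simp add: add_ac)
  ultimately show ?thesis using s t by (intro exI[of _ s] exI[of _ t]) (simp add: mult.assoc)
qed

text \<open>
  For small \<open>h\<close> both second derivatives at \<open>x\<close> are close to the same second difference, divided by
  \<open>h\<^sup>2\<close>, because they are continuous.
\<close>

lemma partial_commute:
  fixes f :: "real^'n::finite \<Rightarrow> real"
  assumes f: "smooth f"
  shows "partial i (partial j f) = partial j (partial i f)"
proof
  fix x
  let ?u = "partial j (partial i f)" and ?v = "partial i (partial j f)"
  have cont: "isCont ?u x" "isCont ?v x"
    by (intro differentiable_imp_continuous_within smooth_differentiable smooth_partial f)+
  have "\<bar>?v x - ?u x\<bar> \<le> e" if e: "e > 0" for e
  proof -
    have e2: "e / 2 > 0" using e by simp
    obtain d1 where d1: "d1 > 0" and u: "\<And>y. dist y x < d1 \<Longrightarrow> dist (?u y) (?u x) < e / 2"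
      using cont(1) e2 unfolding continuous_at_eps_delta by blast
    obtain d2 where d2: "d2 > 0" and v: "\<And>y. dist y x < d2 \<Longrightarrow> dist (?v y) (?v x) < e / 2"
      using cont(2) e2 unfolding continuous_at_eps_delta by blast
    \<comment> \<open>Points of a square with side \<open>h\<close> at \<open>x\<close> are closer to \<open>x\<close> than \<open>2 h\<close>.\<close>
    define h where "h = min d1 d2 / 2"
    have h: "h > 0" "2 * h \<le> d1" "2 * h \<le> d2" using d1 d2 by (auto simp: h_def)
    have near: "dist (x + s *\<^sub>R axis a 1 + t *\<^sub>R axis b 1) x < 2 * h"
      if "0 < s" "s < h" "0 < t" "t < h" for s t and a b :: 'n
    proof -
      have "norm (s *\<^sub>R axis a 1 + t *\<^sub>R axis b (1::real)) \<le> s + t"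
        by (rule norm_triangle_le) (use that in \<open>simp add: norm_axis_1\<close>)
      then show ?thesis using that by (simp add: dist_norm add.assoc)
    qed
    obtain s t where 1: "0 < s" "s < h" "0 < t" "t < h"
      "f (x + h *\<^sub>R axis i 1 + h *\<^sub>R axis j 1) - f (x + h *\<^sub>R axis i 1) - f (x + h *\<^sub>R axis j 1) + f x
      = h * h * ?u (x + s *\<^sub>R axis i 1 + t *\<^sub>R axis j 1)"
      using mixed_difference[OF f h(1), of x i j] by blast
    obtain s' t' where 2: "0 < s'" "s' < h" "0 < t'" "t' < h"
      "f (x + h *\<^sub>R axis j 1 + h *\<^sub>R axis i 1) - f (x + h *\<^sub>R axis j 1) - f (x + h *\<^sub>R axis i 1) + f x
      = h * h * ?v (x + s' *\<^sub>R axis j 1 + t' *\<^sub>R axis i 1)"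
      using mixed_difference[OF f h(1), of x j i] by blast
    have "h * h * ?u (x + s *\<^sub>R axis i 1 + t *\<^sub>R axis j 1) = h * h * ?v (x + s' *\<^sub>R axis j 1 + t' *\<^sub>R axis i 1)"
      using 1(5) 2(5) unfolding add.commute[of "h *\<^sub>R axis j 1"] add.assoc[of x "h *\<^sub>R axis j 1"]
        add.assoc[of x "h *\<^sub>R axis i 1"] by linarith
    then have "?u (x + s *\<^sub>R axis i 1 + t *\<^sub>R axis j 1) = ?v (x + s' *\<^sub>R axis j 1 + t' *\<^sub>R axis i 1)"
      using h by simp
    moreover have "dist (?u (x + s *\<^sub>R axis i 1 + t *\<^sub>R axis j 1)) (?u x) < e / 2"
      using near[OF 1(1-4), of i j] h by (intro u) linarith
    moreover have "dist (?v (x + s' *\<^sub>R axis j 1 + t' *\<^sub>R axis i 1)) (?v x) < e / 2"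
      using near[OF 2(1-4), of j i] h by (intro v) linarith
    ultimately show ?thesis unfolding dist_real_def by linarith
  qed
  then have "\<bar>?v x - ?u x\<bar> \<le> 0" by (rule field_le_epsilon) simp
  then show "?v x = ?u x" by simp
qed

section \<open>Derivatives indexed by multi-indices\<close>

lemma partial_partials:
  "smooth f \<Longrightarrow> partial i (partials is f) = partials is (partial i f)"
  by (induction "is") (simp_all add: partial_commute smooth_partials)

text \<open>
  This is what makes \<open>multi_partial\<close> independent of the list that its choice operator picks.
\<close>

lemma partials_perm:
  assumes "smooth f" "\<And>i. count_list is i = count_list js i"
  shows "partials is f = partials js f"
  using assms(2)
proof (induction "is" arbitrary: js)
  case Nil
  then have "set js = {}" by (metis count_list.simps(1) count_list_0_iff equals0I)
  then show ?case by simp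
next
  case (Cons i "is")
  have "i \<in> set js" using Cons.prems[of i] by (metis count_list_0_iff list.set_intros(1))
  then obtain us vs where js: "js = us @ i # vs" by (meson split_list)
  have "count_list is l = count_list (us @ vs) l" for l
    using Cons.prems[of l] by (simp add: js split: if_splits)
  then have "partials is f = partials (us @ vs) f" by (rule Cons.IH)
  then show ?case
    by (simp add: js partials_append partial_partials smooth_partials assms(1))
qed

lemma count_list_replicate_same: "count_list (replicate m i) j = (if i = j then m else 0)"
  by (induction m) auto

lemma ex_list_with_counts: "\<exists>is. \<forall>i. count_list is i = (a :: 'n::finite \<Rightarrow> nat) i"
proof -
  have "\<exists>is. \<forall>i. count_list is i = (if i \<in> S then a i else 0)" if "finite S" for S
    using that
  proof (induction S)
    case empty
    show ?case by (rule exI[of _ "[]"]) simp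
  next
    case (insert j S)
    then obtain "is" where "\<forall>i. count_list is i = (if i \<in> S then a i else 0)" by blast
    with insert show ?case
      by (intro exI[of _ "replicate (a j) j @ is"]) (auto simp: count_list_replicate_same)
  qed
  from this[of UNIV] show ?thesis by simp
qed

lemma multi_partial_eq_partials:
  assumes "smooth f" "\<And>i. count_list is i = a i"
  shows "multi_partial a f = partials is f"
  unfolding multi_partial_def
  by (rule partials_perm[OF assms(1)]) (simp add: assms(2) someI_ex[OF ex_list_with_counts])

lemma smooth_multi_partial: "smooth f \<Longrightarrow> smooth (multi_partial a f)"
  by (simp add: multi_partial_def smooth_partials)

lemma multi_partial_Suc:
  assumes "smooth f"
  shows "multi_partial (a(i := Suc (a i))) f = partial i (multi_partial a f)"
    and "multi_partial a (partial i f) = partial i (multi_partial a f)"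
proof -
  obtain "is" where "is": "\<And>i. count_list is i = a i" using ex_list_with_counts by blast
  show "multi_partial (a(i := Suc (a i))) f = partial i (multi_partial a f)"
    using multi_partial_eq_partials[OF assms, of "i # is" "a(i := Suc (a i))"]
      multi_partial_eq_partials[OF assms "is"] "is" by auto
  show "multi_partial a (partial i f) = partial i (multi_partial a f)"
    using multi_partial_eq_partials[OF smooth_partial[OF assms] "is"]
      multi_partial_eq_partials[OF assms "is"] partial_partials[OF assms] by auto
qed

text \<open>
  The Leibniz rule for \<open>D\<^sup>a (x\<^sup>j f)\<close> stops after one correction term, because \<open>x\<^sup>j\<close> has constant
  derivatives.  On polynomial forms this correction becomes the derivative \<open>D_xi k j\<close>.
\<close>

lemma partials_coord_mult:
  assumes "smooth f"
  shows "partials is (\<lambda>y. y $ j * f y)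
    = (\<lambda>x. x $ j * partials is f x + real (count_list is j) * partials (remove1 j is) f x)"
proof (induction "is")
  case (Cons i "is")
  have diff: "partials l f differentiable (at x)" for l x
    using assms by (simp add: smooth_partials smooth_differentiable)
  have rm: "partial j (partials (remove1 j is) f) = partials is f" if "count_list is j \<noteq> 0"
  proof -
    have "count_list (j # remove1 j is) i = count_list is i" for i using that by auto
    from partials_perm[OF assms this] show ?thesis by simp
  qed
  have "partials (i # is) (\<lambda>y. y $ j * f y) x = x $ j * partials (i # is) f x
    + (if i = j then partials is f x else 0)
    + real (count_list is j) * partial i (partials (remove1 j is) f) x" for x
    by (simp add: Cons partial_add partial_mult diff differentiable_mult)
  then show ?case using rm by (auto simp: fun_eq_iff algebra_simps)
qed simp

lemma multi_partial_coord_mult: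
  assumes "smooth f"
  shows "multi_partial a (\<lambda>y. y $ j * f y) x
    = x $ j * multi_partial a f x + real (a j) * multi_partial (a(j := a j - 1)) f x"
proof -
  obtain "is" where "is": "\<And>i. count_list is i = a i" using ex_list_with_counts by blast
  have rm: "\<And>i. count_list (remove1 j is) i = (a(j := a j - 1)) i" using "is" by auto
  show ?thesis
    unfolding multi_partial_eq_partials[OF assms "is"] multi_partial_eq_partials[OF assms rm]
      multi_partial_eq_partials[OF smooth_mult[OF smooth_coord assms] "is"]
      partials_coord_mult[OF assms] "is" ..
qed

lemma multi_partial_add:
  assumes "smooth f" "smooth g"
  shows "multi_partial a (\<lambda>y. f y + g y) x = multi_partial a f x + multi_partial a g x"
proof -
  have "partials is (\<lambda>y. f y + g y) = (\<lambda>x. partials is f x + partials is g x)" for "is"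
    by (induction "is")
      (simp_all add: fun_eq_iff[of "partial _ _"] assms partial_add smooth_partials smooth_differentiable)
  then show ?thesis by (simp add: multi_partial_def)
qed

lemma multi_partial_cmult:
  assumes "smooth f"
  shows "multi_partial a (\<lambda>y. c * f y) x = c * multi_partial a f x"
proof -
  have "partials is (\<lambda>y. c * f y) = (\<lambda>x. c * partials is f x)" for "is"
    by (induction "is")
      (simp_all add: fun_eq_iff[of "partial _ _"] assms partial_cmult smooth_partials smooth_differentiable)
  then show ?thesis by (simp add: multi_partial_def)
qed

text \<open>
  Exponentials are common eigenfunctions of all derivatives, with the monomials as eigenvalues.
\<close>

lemma multi_partial_exp_inner:
  "multi_partial a (\<lambda>y. exp (\<xi> \<bullet> y)) x = (\<Prod>i\<in>UNIV. (\<xi> $ i) ^ a i) * exp (\<xi> \<bullet> x)"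
proof -
  have *: "partials is (\<lambda>y. exp (\<xi> \<bullet> y))
    = (\<lambda>x. (\<Prod>i\<in>UNIV. (\<xi> $ i) ^ count_list is i) * exp (\<xi> \<bullet> x))" for "is"
  proof (induction "is")
    case (Cons i "is")
    have "(\<Prod>l\<in>UNIV. (\<xi> $ l) ^ count_list (i # is) l)
      = (\<Prod>l\<in>UNIV. (\<xi> $ l) ^ count_list is l * (if i = l then \<xi> $ l else 1))"
      by (intro prod.cong) auto
    also have "\<dots> = (\<Prod>l\<in>UNIV. (\<xi> $ l) ^ count_list is l) * \<xi> $ i"
      by (simp add: prod.distrib)
    finally show ?case
      using Cons by (simp add: fun_eq_iff[of "partial _ _"] partial_cmult differentiable_exp_inner partial_exp_inner mult.assoc)
  qed simp
  obtain "is" where "is": "\<And>i. count_list is i = a i" using ex_list_with_counts by blast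
  show ?thesis
    using fun_cong[OF *, of "is" x] by (simp add: multi_partial_eq_partials[OF smooth_exp_inner "is"] "is")
qed

section \<open>Monomial operators and polynomial forms\<close>

definition inc :: "'p \<Rightarrow> 'n \<Rightarrow> ('p \<Rightarrow> 'n \<Rightarrow> nat) \<Rightarrow> 'p \<Rightarrow> 'n \<Rightarrow> nat" where
  "inc k i a = a(k := (a k)(i := Suc (a k i)))"

definition dec :: "'p \<Rightarrow> 'n \<Rightarrow> ('p \<Rightarrow> 'n \<Rightarrow> nat) \<Rightarrow> 'p \<Rightarrow> 'n \<Rightarrow> nat" where
  "dec k i a = a(k := (a k)(i := a k i - 1))"

definition xi_power :: "('p::finite \<Rightarrow> 'n::finite \<Rightarrow> nat) \<Rightarrow> real^'n^'p \<Rightarrow> real" where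
  "xi_power a \<xi> = (\<Prod>k\<in>UNIV. \<Prod>i\<in>UNIV. (\<xi> $ k $ i) ^ a k i)"

definition mono_op :: "('p::finite \<Rightarrow> 'n::finite \<Rightarrow> nat) \<Rightarrow> (real^'n \<Rightarrow> real) \<Rightarrow> ('n, 'p) multiop" where
  "mono_op a A f = (if \<forall>k. smooth (f k)
     then (\<lambda>x. A x * (\<Prod>k\<in>UNIV. multi_partial (a k) (f k) x)) else 0)"

definition mono_symb :: "('p::finite \<Rightarrow> 'n::finite \<Rightarrow> nat) \<Rightarrow> (real^'n \<Rightarrow> real) \<Rightarrow> ('n, 'p) symb" where
  "mono_symb a A x \<xi> = A x * xi_power a \<xi>"

text \<open>
  \<open>has_symbol T P\<close> says that some finite sum of monomials represents both the operator \<open>T\<close> and the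
  polynomial \<open>P\<close>.  The inductive form reduces every claim that is additive in \<open>(T, P)\<close> to single
  monomials; \<open>has_symbol_iff\<close> recovers the description by an index set and coefficients.
\<close>

inductive has_symbol :: "('n::finite, 'p::finite) multiop \<Rightarrow> ('n, 'p) symb \<Rightarrow> bool" where
  zero: "has_symbol 0 0"
| add: "has_symbol T P \<Longrightarrow> has_symbol U Q \<Longrightarrow> has_symbol (T + U) (P + Q)"
| mono: "smooth A \<Longrightarrow> has_symbol (mono_op a A) (mono_symb a A)"

lemma prod_fun_upd:
  fixes F :: "'p::finite \<Rightarrow> 'a \<Rightarrow> 'b::comm_monoid_mult"
  shows "(\<Prod>l\<in>UNIV. F l ((f(k := g)) l)) = F k g * (\<Prod>l\<in>UNIV - {k}. F l (f l))"
  by (simp add: prod.remove[of UNIV k])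

lemma xi_power_inc: "xi_power (inc k i a) \<xi> = \<xi> $ k $ i * xi_power a \<xi>"
proof -
  have "xi_power (inc k i a) \<xi> = (\<Prod>j\<in>UNIV. (\<xi> $ k $ j) ^ ((a k)(i := Suc (a k i))) j)
      * (\<Prod>l\<in>UNIV - {k}. \<Prod>j\<in>UNIV. (\<xi> $ l $ j) ^ a l j)"
    unfolding xi_power_def inc_def
    by (rule prod_fun_upd[where F = "\<lambda>l b. \<Prod>j\<in>UNIV. (\<xi> $ l $ j) ^ b j"])
  also have "(\<Prod>j\<in>UNIV. (\<xi> $ k $ j) ^ ((a k)(i := Suc (a k i))) j)
      = \<xi> $ k $ i * (\<Prod>j\<in>UNIV. (\<xi> $ k $ j) ^ a k j)"
    by (simp add: prod.remove[of UNIV i])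
  finally show ?thesis by (simp add: xi_power_def prod.remove[of UNIV k] mult.assoc)
qed

text \<open>
  The product over \<open>k\<close> and \<open>i\<close> is flattened to one over pairs, where the product rule applies once.
  If \<open>a k i = 0\<close>, the truncated exponent \<open>a k i - 1\<close> in \<open>dec\<close> is harmless, as its factor \<open>a k i\<close> vanishes.
\<close>

lemma has_derivative_xi_power:
  fixes a :: "'p::finite \<Rightarrow> 'n::finite \<Rightarrow> nat"
  shows "(xi_power a has_derivative
    (\<lambda>h. \<Sum>k\<in>UNIV. \<Sum>i\<in>UNIV. h $ k $ i * (real (a k i) * xi_power (dec k i a) \<xi>))) (at \<xi>)"
proof -
  let ?g = "\<lambda>p (\<xi>::real^'n^'p). (\<xi> $ fst p $ snd p) ^ a (fst p) (snd p)"
  have flat: "xi_power b \<eta> = (\<Prod>p\<in>UNIV. (\<eta> $ fst p $ snd p) ^ b (fst p) (snd p))"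
    for b and \<eta> :: "real^'n^'p"
    by (simp add: xi_power_def prod.cartesian_product case_prod_beta)
  have coord: "((\<lambda>\<xi>::real^'n^'p. \<xi> $ k $ i) has_derivative (\<lambda>h. h $ k $ i)) (at \<xi>)" for k i
    by (intro bounded_linear_imp_has_derivative
        bounded_linear_compose[OF bounded_linear_vec_nth bounded_linear_vec_nth])
  have "(?g p has_derivative (\<lambda>h. h $ fst p $ snd p *
      (real (a (fst p) (snd p)) * (\<xi> $ fst p $ snd p) ^ (a (fst p) (snd p) - 1)))) (at \<xi>)" for p
    using has_derivative_power[OF coord, of "fst p" "snd p" "a (fst p) (snd p)"]
    by (simp add: mult_ac)
  from has_derivative_prod[of UNIV ?g, OF this]
  have "(xi_power a has_derivative (\<lambda>h. \<Sum>p\<in>UNIV. h $ fst p $ snd p *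
      (real (a (fst p) (snd p)) * (\<xi> $ fst p $ snd p) ^ (a (fst p) (snd p) - 1))
      * (\<Prod>q\<in>UNIV - {p}. ?g q \<xi>))) (at \<xi>)"
    by (simp add: flat[abs_def])
  also have "(\<lambda>h. \<Sum>p\<in>UNIV. h $ fst p $ snd p *
      (real (a (fst p) (snd p)) * (\<xi> $ fst p $ snd p) ^ (a (fst p) (snd p) - 1))
      * (\<Prod>q\<in>UNIV - {p}. ?g q \<xi>))
     = (\<lambda>h. \<Sum>p\<in>UNIV. h $ fst p $ snd p *
      (real (a (fst p) (snd p)) * xi_power (dec (fst p) (snd p) a) \<xi>))"
  proof (intro ext sum.cong refl)
    fix h :: "real^'n^'p" and p :: "'p \<times> 'n"
    have "xi_power (dec (fst p) (snd p) a) \<xi> = (\<xi> $ fst p $ snd p) ^ (a (fst p) (snd p) - 1)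
      * (\<Prod>q\<in>UNIV - {p}. (\<xi> $ fst q $ snd q) ^ dec (fst p) (snd p) a (fst q) (snd q))"
      unfolding flat by (subst prod.remove[of UNIV p]) (auto simp: dec_def)
    also have "(\<Prod>q\<in>UNIV - {p}. (\<xi> $ fst q $ snd q) ^ dec (fst p) (snd p) a (fst q) (snd q))
      = (\<Prod>q\<in>UNIV - {p}. ?g q \<xi>)"
      by (intro prod.cong) (auto simp: dec_def prod_eq_iff)
    finally show "h $ fst p $ snd p *
      (real (a (fst p) (snd p)) * (\<xi> $ fst p $ snd p) ^ (a (fst p) (snd p) - 1))
      * (\<Prod>q\<in>UNIV - {p}. ?g q \<xi>)
      = h $ fst p $ snd p * (real (a (fst p) (snd p)) * xi_power (dec (fst p) (snd p) a) \<xi>)"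
      by simp
  qed
  also have "\<dots> = (\<lambda>h. \<Sum>k\<in>UNIV. \<Sum>i\<in>UNIV. h $ k $ i * (real (a k i) * xi_power (dec k i a) \<xi>))"
    by (simp add: sum.cartesian_product case_prod_beta)
  finally show ?thesis .
qed

lemma D_xi_eq: "(P x has_derivative f') (at \<xi>) \<Longrightarrow> D_xi k i P x \<xi> = f' (axis k (axis i 1))"
  unfolding D_xi_def using frechet_derivative_at by metis

lemma D_xi_mono_symb:
  fixes a :: "'p::finite \<Rightarrow> 'n::finite \<Rightarrow> nat"
  shows "D_xi k i (mono_symb a A) = mono_symb (dec k i a) (\<lambda>x. real (a k i) * A x)"
proof (intro ext)
  fix x and \<xi> :: "real^'n^'p"
  have "mono_symb a A x = (\<lambda>\<xi>. A x * xi_power a \<xi>)" by (simp add: fun_eq_iff mono_symb_def)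
  then have "(mono_symb a A x has_derivative (\<lambda>h. A x *
      (\<Sum>k\<in>UNIV. \<Sum>i\<in>UNIV. h $ k $ i * (real (a k i) * xi_power (dec k i a) \<xi>)))) (at \<xi>)"
    by (simp only:) (intro has_derivative_mult_right has_derivative_xi_power)
  from D_xi_eq[of "mono_symb a A", OF this, of k i]
  have "D_xi k i (mono_symb a A) x \<xi> = A x * (\<Sum>l\<in>UNIV. \<Sum>j\<in>UNIV.
      (if l = k \<and> j = i then real (a l j) * xi_power (dec l j a) \<xi> else 0))"
    by (auto simp: axis_def intro!: sum.cong)
  also have "(\<Sum>l\<in>UNIV. \<Sum>j\<in>UNIV. (if l = k \<and> j = i then real (a l j) * xi_power (dec l j a) \<xi> else 0))
      = (\<Sum>l\<in>UNIV. if l = k then (\<Sum>j\<in>UNIV. if j = i then real (a l j) * xi_power (dec l j a) \<xi> else 0) else 0)"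
    by (intro sum.cong) auto
  finally show "D_xi k i (mono_symb a A) x \<xi> = mono_symb (dec k i a) (\<lambda>x. real (a k i) * A x) x \<xi>"
    by (simp add: mono_symb_def[abs_def])
qed

lemma symbol_differentiable: "has_symbol T P \<Longrightarrow> P x differentiable (at \<xi>)"
proof (induction rule: has_symbol.induct)
  case zero
  then show ?case by (simp add: zero_fun_def)
next
  case (add T P U Q)
  then show ?case by (simp add: plus_fun_def differentiable_add)
next
  case (mono A a)
  have "mono_symb a A x = (\<lambda>\<xi>. A x * xi_power a \<xi>)" by (simp add: fun_eq_iff mono_symb_def)
  then show ?case
    using has_derivative_mult_right[OF has_derivative_xi_power] by (auto simp: differentiable_def)
qed

lemma symbol_smooth: "has_symbol T P \<Longrightarrow> smooth (\<lambda>y. P y \<xi>)"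
  by (induction rule: has_symbol.induct) (auto simp: mono_symb_def intro: smooth_intros)

lemma sum_fun_apply: "(\<Sum>i\<in>I. F i) x = (\<Sum>i\<in>I. F i x)"
  by (induction I rule: infinite_finite_induct) simp_all

lemma has_symbol_multidiff:
  assumes "finite I" "\<And>a. a \<in> I \<Longrightarrow> smooth (A a)"
  shows "has_symbol (multidiff_of I A) (symbol_of I A)"
  using assms
proof (induction I)
  case empty
  have "multidiff_of {} A = 0" "symbol_of {} A = 0"
    by (auto simp: multidiff_of_def symbol_of_def fun_eq_iff)
  then show ?case by (simp only: has_symbol.zero)
next
  case (insert a I)
  have "multidiff_of (insert a I) A = mono_op a (A a) + multidiff_of I A"
    using insert by (auto simp: multidiff_of_def mono_op_def fun_eq_iff)
  moreover have "symbol_of (insert a I) A = mono_symb a (A a) + symbol_of I A"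
    using insert by (auto simp: symbol_of_def mono_symb_def xi_power_def fun_eq_iff)
  moreover have "has_symbol (mono_op a (A a) + multidiff_of I A) (mono_symb a (A a) + symbol_of I A)"
    using insert by (intro has_symbol.add has_symbol.mono) auto
  ultimately show ?case by (simp only:)
qed

lemma multidiff_of_add:
  "multidiff_of I A + multidiff_of I B = multidiff_of I (\<lambda>a x. A a x + B a x)"
  "symbol_of I A + symbol_of I B = symbol_of I (\<lambda>a x. A a x + B a x)"
  by (auto simp: multidiff_of_def symbol_of_def fun_eq_iff sum.distrib distrib_right)

text \<open>
  Padding the coefficients by zero lets two representations share one index set before they are added.
\<close>

lemma multidiff_of_extend:
  assumes "finite J" "I \<subseteq> J"
  shows "multidiff_of J (\<lambda>a. if a \<in> I then A a else (\<lambda>x. 0)) = multidiff_of I A"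
    and "symbol_of J (\<lambda>a. if a \<in> I then A a else (\<lambda>x. 0)) = symbol_of I A"
proof -
  have *: "(\<Sum>a\<in>J. (if a \<in> I then A a else (\<lambda>x. 0)) x * F a) = (\<Sum>a\<in>I. A a x * F a)" for x F
    by (rule sum.mono_neutral_cong_right) (use assms in auto)
  show "multidiff_of J (\<lambda>a. if a \<in> I then A a else (\<lambda>x. 0)) = multidiff_of I A"
    by (simp add: multidiff_of_def fun_eq_iff *)
  show "symbol_of J (\<lambda>a. if a \<in> I then A a else (\<lambda>x. 0)) = symbol_of I A"
    by (simp add: symbol_of_def fun_eq_iff *)
qed

lemma has_symbol_iff:
  "has_symbol T P \<longleftrightarrow> (\<exists>I A. finite I \<and> (\<forall>a\<in>I. smooth (A a)) \<and>
      T = multidiff_of I A \<and> P = symbol_of I A)"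
proof
  assume "has_symbol T P"
  then show "\<exists>I A. finite I \<and> (\<forall>a\<in>I. smooth (A a)) \<and> T = multidiff_of I A \<and> P = symbol_of I A"
  proof (induction rule: has_symbol.induct)
    case zero
    show ?case
      by (rule exI[of _ "{}"]) (auto simp: multidiff_of_def symbol_of_def fun_eq_iff)
  next
    case (add T P U Q)
    from add.IH obtain I A J B where fin: "finite I" "finite J"
      and sm: "\<forall>a\<in>I. smooth (A a)" "\<forall>a\<in>J. smooth (B a)"
      and eq: "T = multidiff_of I A" "P = symbol_of I A" "U = multidiff_of J B" "Q = symbol_of J B"
      by (elim exE conjE)
    let ?A = "\<lambda>a. if a \<in> I then A a else (\<lambda>x. 0)" and ?B = "\<lambda>a. if a \<in> J then B a else (\<lambda>x. 0)"
    let ?C = "\<lambda>a x. ?A a x + ?B a x"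
    have K: "finite (I \<union> J)" "I \<subseteq> I \<union> J" "J \<subseteq> I \<union> J" using fin by auto
    have "T + U = multidiff_of (I \<union> J) ?C" "P + Q = symbol_of (I \<union> J) ?C"
      unfolding eq multidiff_of_extend[OF K(1,2), of A, symmetric]
        multidiff_of_extend[OF K(1,3), of B, symmetric] by (rule multidiff_of_add)+
    moreover have "smooth (?A a)" "smooth (?B a)" for a
      using sm by (cases "a \<in> I"; cases "a \<in> J"; simp)+
    then have "\<forall>a\<in>I \<union> J. smooth (?C a)" by (intro ballI smooth_add)
    ultimately show ?case using K(1) by (intro exI[of _ "I \<union> J"] exI[of _ ?C] conjI)
  next
    case (mono A a)
    have "mono_op a A = multidiff_of {a} (\<lambda>_. A)" "mono_symb a A = symbol_of {a} (\<lambda>_. A)"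
      by (auto simp: mono_op_def mono_symb_def xi_power_def multidiff_of_def symbol_of_def fun_eq_iff)
    then show ?case using mono by (intro exI[of _ "{a}"] exI[of _ "\<lambda>_. A"]) auto
  qed
qed (auto intro: has_symbol_multidiff)

lemma multidiff_ops_iff: "T \<in> multidiff_ops \<longleftrightarrow> (\<exists>P. has_symbol T P)"
  unfolding multidiff_ops_def has_symbol_iff by auto

lemma symbols_iff: "P \<in> symbols \<longleftrightarrow> (\<exists>T. has_symbol T P)"
  unfolding symbols_def has_symbol_iff by auto

text \<open>
  Applying an operator to exponentials evaluates its polynomial form, up to a nonvanishing factor.
  This shows that the polynomial form depends on the operator alone, not on the chosen index set and
  coefficients.
\<close>

lemma has_symbol_exp:
  assumes "has_symbol T P"
  shows "T (\<lambda>k y. exp (\<xi> $ k \<bullet> y)) x = P x \<xi> * (\<Prod>k\<in>UNIV. exp (\<xi> $ k \<bullet> x))"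
  using assms
proof (induction rule: has_symbol.induct)
  case (mono A a)
  show ?case
    by (simp add: mono_op_def mono_symb_def xi_power_def smooth_exp_inner multi_partial_exp_inner
        prod.distrib)
qed (simp_all add: distrib_right)

lemma has_symbol_unique: "has_symbol T P \<Longrightarrow> has_symbol T Q \<Longrightarrow> P = Q"
proof (intro ext)
  fix x \<xi> assume "has_symbol T P" "has_symbol T Q"
  from this[THEN has_symbol_exp, of \<xi> x] show "P x \<xi> = Q x \<xi>" by simp
qed

lemma polynomial_form_eq: "has_symbol T P \<Longrightarrow> polynomial_form T = P"
  unfolding polynomial_form_def has_symbol_iff[symmetric]
  by (rule the_equality) (auto intro: has_symbol_unique)

section \<open>Operations on operators and their effect on polynomial forms\<close>

lemma has_symbol_cong: "has_symbol T P \<Longrightarrow> T = U \<Longrightarrow> P = Q \<Longrightarrow> has_symbol U Q"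
  by simp

lemma has_symbol_mult:
  assumes "smooth g" "has_symbol T P"
  shows "has_symbol (\<lambda>f x. g x * T f x) (\<lambda>x \<xi>. g x * P x \<xi>)"
  using assms(2)
proof (induction rule: has_symbol.induct)
  case zero
  show ?case by (rule has_symbol_cong[OF has_symbol.zero]) (simp_all add: fun_eq_iff)
next
  case (add T P U Q)
  from has_symbol.add[OF add.IH] show ?case
    by (rule has_symbol_cong) (simp_all add: fun_eq_iff distrib_left)
next
  case (mono A a)
  from has_symbol.mono[OF smooth_mult[OF assms(1) mono], of a] show ?case
    by (rule has_symbol_cong) (auto simp: fun_eq_iff mono_op_def mono_symb_def)
qed

lemma has_symbol_cmult: "has_symbol T P \<Longrightarrow> has_symbol (\<lambda>f x. c * T f x) (\<lambda>x \<xi>. c * P x \<xi>)"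
  using has_symbol_mult[of "\<lambda>_. c"] by simp

lemma has_symbol_uminus: "has_symbol T P \<Longrightarrow> has_symbol (- T) (- P)"
  by (rule has_symbol_cong[OF has_symbol_cmult[of T P "-1"]]) (simp_all add: fun_eq_iff)

lemma has_symbol_diff: "has_symbol T P \<Longrightarrow> has_symbol U Q \<Longrightarrow> has_symbol (T - U) (P - Q)"
  using has_symbol.add[OF _ has_symbol_uminus] by fastforce

lemma has_symbol_sum:
  "(\<And>i. i \<in> I \<Longrightarrow> has_symbol (T i) (P i)) \<Longrightarrow> has_symbol (\<Sum>i\<in>I. T i) (\<Sum>i\<in>I. P i)"
  by (induction I rule: infinite_finite_induct) (auto intro: has_symbol.intros)

lemma has_symbol_nonsmooth: "has_symbol T P \<Longrightarrow> \<not> (\<forall>k. smooth (f k)) \<Longrightarrow> T f = 0"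
  by (induction rule: has_symbol.induct) (auto simp: mono_op_def)

lemma has_symbol_smooth:
  assumes "has_symbol T P" "\<And>k. smooth (f k)"
  shows "smooth (T f)"
  using assms(1)
proof (induction rule: has_symbol.induct)
  case zero
  then show ?case by (simp add: zero_fun_def)
next
  case (add T P U Q)
  then show ?case by (simp add: plus_fun_def smooth_add)
next
  case (mono A a)
  then show ?case using assms(2)
    by (auto simp: mono_op_def intro!: smooth_intros smooth_multi_partial)
qed

definition dx :: "'n::finite \<Rightarrow> ('n, 'p::finite) symb \<Rightarrow> ('n, 'p) symb" where
  "dx i P x \<xi> = partial i (\<lambda>y. P y \<xi>) x"

lemma dx_mono_symb: "smooth A \<Longrightarrow> dx i (mono_symb a A) = mono_symb a (partial i A)"
  by (simp add: fun_eq_iff dx_def mono_symb_def partial_mult smooth_differentiable)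

lemma has_symbol_dx_add:
  "has_symbol T P \<Longrightarrow> has_symbol U Q \<Longrightarrow> dx i (P + Q) = dx i P + dx i Q"
  by (simp add: fun_eq_iff dx_def partial_add symbol_smooth smooth_differentiable)

lemma has_symbol_D_xi_add:
  assumes "has_symbol T P" "has_symbol U Q"
  shows "D_xi k i (P + Q) = D_xi k i P + D_xi k i Q"
proof (intro ext)
  fix x \<xi>
  obtain P' Q' where d: "(P x has_derivative P') (at \<xi>)" "(Q x has_derivative Q') (at \<xi>)"
    using assms[THEN symbol_differentiable] unfolding differentiable_def by blast
  then have "((P + Q) x has_derivative (\<lambda>h. P' h + Q' h)) (at \<xi>)"
    by (simp add: plus_fun_def has_derivative_add)
  then show "D_xi k i (P + Q) x \<xi> = (D_xi k i P + D_xi k i Q) x \<xi>"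
    using d by (simp add: D_xi_eq)
qed

lemma partial_prod:
  fixes f :: "'a \<Rightarrow> real^'n::finite \<Rightarrow> real"
  assumes "finite I" "\<And>a. a \<in> I \<Longrightarrow> f a differentiable (at x)"
  shows "partial i (\<lambda>y. \<Prod>a\<in>I. f a y) x = (\<Sum>a\<in>I. partial i (f a) x * (\<Prod>b\<in>I - {a}. f b x))"
proof -
  have "\<And>a. a \<in> I \<Longrightarrow> (f a has_derivative frechet_derivative (f a) (at x)) (at x)"
    using assms(2) frechet_derivative_works by blast
  then have "((\<lambda>y. \<Prod>a\<in>I. f a y) has_derivative
      (\<lambda>h. \<Sum>a\<in>I. frechet_derivative (f a) (at x) h * (\<Prod>b\<in>I - {a}. f b x))) (at x)"
    by (rule has_derivative_prod)
  from partial_eq[OF this, of i] show ?thesis by (simp add: partial_def[of i "f _"])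
qed

lemma partial_zero: "partial i 0 = 0"
  by (simp add: fun_eq_iff zero_fun_def)

text \<open>
  By the product rule, \<open>\<partial>\<^sub>i\<close> applied to \<open>T(f\<^sub>1, \<dots>, f\<^sub>p)\<close> hits the coefficients or one of the arguments.
\<close>

lemma has_symbol_partial:
  fixes T :: "('n::finite, 'p::finite) multiop"
  assumes "has_symbol T P"
  shows "has_symbol (\<lambda>f. partial i (T f)) (dx i P + (\<Sum>k\<in>UNIV. (\<lambda>x \<xi>. \<xi> $ k $ i * P x \<xi>)))"
  using assms
proof (induction rule: has_symbol.induct)
  case zero
  show ?case
    by (rule has_symbol_cong[OF has_symbol.zero]) (simp_all add: fun_eq_iff zero_fun_def dx_def sum_fun_apply)
next
  case (add T P U Q)
  have "partial i ((T + U) f) = partial i (T f) + partial i (U f)" for f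
  proof (cases "\<forall>k. smooth (f k)")
    case True
    then show ?thesis
      using add.hyps by (simp add: plus_fun_def fun_eq_iff partial_add has_symbol_smooth smooth_differentiable)
  next
    case False
    then have "T f = 0" "U f = 0" using add.hyps[THEN has_symbol_nonsmooth, of f] by simp_all
    then have "(T + U) f = 0" by (simp only: plus_fun_apply add_0)
    with \<open>T f = 0\<close> \<open>U f = 0\<close> show ?thesis by (simp only: partial_zero add_0)
  qed
  then have "(\<lambda>f. partial i ((T + U) f)) = (\<lambda>f. partial i (T f)) + (\<lambda>f. partial i (U f))"
    by (simp add: fun_eq_iff)
  moreover have "dx i (P + Q) + (\<Sum>k\<in>UNIV. (\<lambda>x \<xi>. \<xi> $ k $ i * (P + Q) x \<xi>))
      = (dx i P + (\<Sum>k\<in>UNIV. (\<lambda>x \<xi>. \<xi> $ k $ i * P x \<xi>)))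
        + (dx i Q + (\<Sum>k\<in>UNIV. (\<lambda>x \<xi>. \<xi> $ k $ i * Q x \<xi>)))"
    unfolding has_symbol_dx_add[OF add.hyps]
    by (simp add: fun_eq_iff sum_fun_apply distrib_left sum.distrib)
  ultimately show ?case using has_symbol.add[OF add.IH] by (simp only:)
next
  case (mono A a)
  have "(\<lambda>f. partial i (mono_op a A f)) = mono_op a (partial i A) + (\<Sum>k\<in>UNIV. mono_op (inc k i a) A)"
  proof (intro ext)
    fix f :: "'p \<Rightarrow> real^'n \<Rightarrow> real" and x
    show "partial i (mono_op a A f) x = (mono_op a (partial i A) + (\<Sum>k\<in>UNIV. mono_op (inc k i a) A)) f x"
    proof (cases "\<forall>k. smooth (f k)")
      case True
      have d: "A differentiable (at x)" "multi_partial (a k) (f k) differentiable (at x)" for k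
        using True mono by (simp_all add: smooth_multi_partial smooth_differentiable)
      have "partial i (mono_op a A f) x = A x * partial i (\<lambda>x. \<Prod>k\<in>UNIV. multi_partial (a k) (f k) x) x
          + partial i A x * (\<Prod>k\<in>UNIV. multi_partial (a k) (f k) x)"
        using True mono
        by (simp add: mono_op_def partial_mult smooth_differentiable smooth_prod smooth_multi_partial)
      also have "partial i (\<lambda>x. \<Prod>k\<in>UNIV. multi_partial (a k) (f k) x) x
          = (\<Sum>k\<in>UNIV. \<Prod>l\<in>UNIV. multi_partial (inc k i a l) (f l) x)"
        unfolding partial_prod[OF finite d(2)]
      proof (intro sum.cong refl)
        fix k
        show "partial i (multi_partial (a k) (f k)) x * (\<Prod>l\<in>UNIV - {k}. multi_partial (a l) (f l) x)
          = (\<Prod>l\<in>UNIV. multi_partial (inc k i a l) (f l) x)"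
          using True unfolding inc_def
          by (subst prod_fun_upd[where F = "\<lambda>l b. multi_partial b (f l) x"]) (simp add: multi_partial_Suc)
      qed
      finally show ?thesis
        using True by (simp add: mono_op_def sum_fun_apply sum_distrib_left)
    qed (simp only: mono_op_def sum_fun_apply partial_zero if_False plus_fun_apply zero_fun_apply
        sum.neutral_const add_0)
  qed
  moreover have "dx i (mono_symb a A) + (\<Sum>k\<in>UNIV. (\<lambda>x \<xi>. \<xi> $ k $ i * mono_symb a A x \<xi>))
      = mono_symb a (partial i A) + (\<Sum>k\<in>UNIV. mono_symb (inc k i a) A)"
    using mono by (simp add: dx_mono_symb) (simp add: fun_eq_iff sum_fun_apply mono_symb_def xi_power_inc mult_ac)
  moreover have "has_symbol (mono_op a (partial i A) + (\<Sum>k\<in>UNIV. mono_op (inc k i a) A))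
      (mono_symb a (partial i A) + (\<Sum>k\<in>UNIV. mono_symb (inc k i a) A))"
    by (intro has_symbol.add has_symbol.mono has_symbol_sum smooth_partial mono)
  ultimately show ?case by (simp only:)
qed

text \<open>
  Composition of an operator with \<open>\<Phi>\<close> in its \<open>k\<close>-th argument.  The test for smoothness keeps the
  convention that operators vanish on tuples that are not smooth: \<open>\<Phi> (f k)\<close> may be smooth when \<open>f k\<close> is not.
\<close>

definition slot ::
  "'p::finite \<Rightarrow> ((real^'n::finite \<Rightarrow> real) \<Rightarrow> real^'n \<Rightarrow> real) \<Rightarrow> ('n, 'p) multiop \<Rightarrow> ('n, 'p) multiop" where
  "slot k \<Phi> T f = (if \<forall>l. smooth (f l) then T (f(k := \<Phi> (f k))) else 0)"

lemma slot_zero: "slot k \<Phi> 0 = 0" and slot_plus: "slot k \<Phi> (T + U) = slot k \<Phi> T + slot k \<Phi> U"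
  by (auto simp: slot_def fun_eq_iff)

lemma mono_op_upd:
  assumes "\<forall>l. smooth (f l)" "smooth g"
  shows "mono_op a A (f(k := g)) x
    = A x * multi_partial (a k) g x * (\<Prod>l\<in>UNIV - {k}. multi_partial (a l) (f l) x)"
proof -
  have "(\<Prod>l\<in>UNIV. multi_partial (a l) ((f(k := g)) l) x)
    = multi_partial (a k) g x * (\<Prod>l\<in>UNIV - {k}. multi_partial (a l) (f l) x)"
    by (rule prod_fun_upd[where F = "\<lambda>l g. multi_partial (a l) g x"])
  moreover have "\<forall>l. smooth ((f(k := g)) l)" using assms by simp
  ultimately show ?thesis unfolding mono_op_def by simp
qed

lemma mono_op_index_upd:
  assumes "\<forall>l. smooth (f l)"
  shows "mono_op (a(k := b)) A f x
    = A x * multi_partial b (f k) x * (\<Prod>l\<in>UNIV - {k}. multi_partial (a l) (f l) x)"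
proof -
  have "(\<Prod>l\<in>UNIV. multi_partial ((a(k := b)) l) (f l) x)
    = multi_partial b (f k) x * (\<Prod>l\<in>UNIV - {k}. multi_partial (a l) (f l) x)"
    by (rule prod_fun_upd[where F = "\<lambda>l b. multi_partial b (f l) x"])
  then show ?thesis using assms unfolding mono_op_def by simp
qed

lemma has_symbol_slot_partial:
  fixes T :: "('n::finite, 'p::finite) multiop"
  assumes "has_symbol T P"
  shows "has_symbol (slot k (partial i) T) (\<lambda>x \<xi>. \<xi> $ k $ i * P x \<xi>)"
  using assms
proof (induction rule: has_symbol.induct)
  case zero
  have "0 = (\<lambda>x \<xi>. \<xi> $ k $ i * (0 :: ('n, 'p) symb) x \<xi>)" by (simp add: fun_eq_iff)
  with has_symbol.zero slot_zero[symmetric] show ?case by (rule has_symbol_cong)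
next
  case (add T P U Q)
  have "(\<lambda>x \<xi>. \<xi> $ k $ i * P x \<xi>) + (\<lambda>x \<xi>. \<xi> $ k $ i * Q x \<xi>) = (\<lambda>x \<xi>. \<xi> $ k $ i * (P + Q) x \<xi>)"
    by (simp add: fun_eq_iff distrib_left)
  with has_symbol.add[OF add.IH] slot_plus[symmetric] show ?case by (rule has_symbol_cong)
next
  case (mono A a)
  from has_symbol.mono[OF mono, of "inc k i a"] show ?case
  proof (rule has_symbol_cong)
    show "mono_op (inc k i a) A = slot k (partial i) (mono_op a A)"
    proof (intro ext)
      fix f x
      show "mono_op (inc k i a) A f x = slot k (partial i) (mono_op a A) f x"
      proof (cases "\<forall>l. smooth (f l)")
        case True
        then show ?thesis
          unfolding inc_def mono_op_index_upd[OF True] slot_def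
          by (simp add: mono_op_upd smooth_partial multi_partial_Suc)
      qed (simp only: slot_def mono_op_def if_False plus_fun_apply zero_fun_apply add_0)
    qed
  qed (simp add: fun_eq_iff mono_symb_def xi_power_inc)
qed

text \<open>
  Precomposition with multiplication by \<open>x\<^sup>j\<close> acts on polynomial forms as \<open>x\<^sup>j + D\<^bsub>\<xi>\<^sup>k\<^sub>j\<^esub>\<close>: the derivative is the
  correction term of the Leibniz rule in \<open>multi_partial_coord_mult\<close>.
\<close>

lemma has_symbol_slot_coord:
  fixes T :: "('n::finite, 'p::finite) multiop"
  assumes "has_symbol T P"
  shows "has_symbol (slot k (\<lambda>f y. y $ j * f y) T) (\<lambda>x \<xi>. x $ j * P x \<xi> + D_xi k j P x \<xi>)"
  using assms
proof (induction rule: has_symbol.induct)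
  case zero
  have "0 = (\<lambda>x \<xi>. x $ j * (0 :: ('n, 'p) symb) x \<xi> + D_xi k j 0 x \<xi>)"
    by (simp add: fun_eq_iff D_xi_def zero_fun_def)
  with has_symbol.zero slot_zero[symmetric] show ?case by (rule has_symbol_cong)
next
  case (add T P U Q)
  have "(\<lambda>x \<xi>. x $ j * P x \<xi> + D_xi k j P x \<xi>) + (\<lambda>x \<xi>. x $ j * Q x \<xi> + D_xi k j Q x \<xi>)
      = (\<lambda>x \<xi>. x $ j * (P + Q) x \<xi> + D_xi k j (P + Q) x \<xi>)"
    unfolding has_symbol_D_xi_add[OF add.hyps] by (simp add: fun_eq_iff distrib_left)
  with has_symbol.add[OF add.IH] slot_plus[symmetric] show ?case by (rule has_symbol_cong)
next
  case (mono A a)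
  let ?B = "\<lambda>x. real (a k j) * A x"
  have "smooth (\<lambda>x. x $ j * A x)" "smooth ?B" using mono by (auto intro: smooth_intros)
  then have "has_symbol (mono_op a (\<lambda>x. x $ j * A x) + mono_op (dec k j a) ?B)
      (mono_symb a (\<lambda>x. x $ j * A x) + mono_symb (dec k j a) ?B)"
    by (intro has_symbol.intros)
  then show ?case
  proof (rule has_symbol_cong)
    show "mono_op a (\<lambda>x. x $ j * A x) + mono_op (dec k j a) ?B = slot k (\<lambda>f y. y $ j * f y) (mono_op a A)"
    proof (intro ext)
      fix f :: "'p \<Rightarrow> real^'n \<Rightarrow> real" and x
      show "(mono_op a (\<lambda>x. x $ j * A x) + mono_op (dec k j a) ?B) f x
        = slot k (\<lambda>f y. y $ j * f y) (mono_op a A) f x"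
      proof (cases "\<forall>l. smooth (f l)")
        case True
        have "mono_op a (\<lambda>x. x $ j * A x) f x = x $ j * A x * multi_partial (a k) (f k) x
            * (\<Prod>l\<in>UNIV - {k}. multi_partial (a l) (f l) x)"
          using mono_op_index_upd[OF True, of a k "a k"] by simp
        with True show ?thesis
          unfolding dec_def plus_fun_apply mono_op_index_upd[OF True] slot_def
          by (simp add: mono_op_upd smooth_mult multi_partial_coord_mult algebra_simps)
      qed (simp only: slot_def mono_op_def if_False plus_fun_apply zero_fun_apply add_0)
    qed
  qed (simp add: fun_eq_iff D_xi_mono_symb, simp add: mono_symb_def)
qed

lemma has_symbol_upd_add:
  assumes "has_symbol T P" "\<forall>l. smooth (f l)" "smooth g" "smooth h"
  shows "T (f(k := \<lambda>y. g y + h y)) x = T (f(k := g)) x + T (f(k := h)) x"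
  using assms(1)
proof (induction rule: has_symbol.induct)
  case (mono A a)
  show ?case
    unfolding mono_op_upd[OF assms(2,3)] mono_op_upd[OF assms(2,4)]
      mono_op_upd[OF assms(2) smooth_add[OF assms(3,4)]] multi_partial_add[OF assms(3,4)]
    by (simp add: algebra_simps)
qed simp_all

lemma has_symbol_upd_cmult:
  assumes "has_symbol T P" "\<forall>l. smooth (f l)" "smooth g"
  shows "T (f(k := \<lambda>y. c * g y)) x = c * T (f(k := g)) x"
  using assms(1)
proof (induction rule: has_symbol.induct)
  case (mono A a)
  have cg: "smooth (\<lambda>y. c * g y)" using assms(3) by (simp add: smooth_mult)
  show ?case
    unfolding mono_op_upd[OF assms(2,3)] mono_op_upd[OF assms(2) cg] multi_partial_cmult[OF assms(3)]
    by (simp add: algebra_simps)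
qed (simp_all add: algebra_simps)

lemma has_symbol_upd_sum:
  assumes "has_symbol T P" "\<forall>l. smooth (f l)" "\<And>i. i \<in> I \<Longrightarrow> smooth (g i)"
  shows "T (f(k := \<lambda>y. \<Sum>i\<in>I. g i y)) x = (\<Sum>i\<in>I. T (f(k := g i)) x)"
  using assms(3)
proof (induction I rule: infinite_finite_induct)
  case (insert i I)
  have "T (f(k := \<lambda>y. g i y + (\<Sum>i\<in>I. g i y))) x = T (f(k := g i)) x + T (f(k := \<lambda>y. \<Sum>i\<in>I. g i y)) x"
    by (rule has_symbol_upd_add[OF assms(1,2)]) (simp_all add: smooth_sum insert.prems)
  also have "T (f(k := \<lambda>y. \<Sum>i\<in>I. g i y)) x = (\<Sum>i\<in>I. T (f(k := g i)) x)"
    by (rule insert.IH) (simp add: insert.prems)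
  finally show ?case unfolding sum.insert[OF insert.hyps] .
qed (use has_symbol_upd_cmult[OF assms(1,2), of "\<lambda>_. 0" k 0 x] in simp_all)

section \<open>Closure and commutation rules for symbols\<close>

lemma symbols_zero: "0 \<in> symbols"
  unfolding symbols_iff using has_symbol.zero by blast

lemma symbols_add: "P \<in> symbols \<Longrightarrow> Q \<in> symbols \<Longrightarrow> P + Q \<in> symbols"
  unfolding symbols_iff using has_symbol.add by blast

lemma symbols_uminus: "P \<in> symbols \<Longrightarrow> - P \<in> symbols"
  unfolding symbols_iff using has_symbol_uminus by blast

lemma symbols_diff: "P \<in> symbols \<Longrightarrow> Q \<in> symbols \<Longrightarrow> P - Q \<in> symbols"
  unfolding symbols_iff using has_symbol_diff by blast

lemma symbols_sum: "(\<And>i. i \<in> I \<Longrightarrow> P i \<in> symbols) \<Longrightarrow> (\<Sum>i\<in>I. P i) \<in> symbols"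
  by (induction I rule: infinite_finite_induct) (auto intro: symbols_zero symbols_add)

lemma symbols_mult: "smooth g \<Longrightarrow> P \<in> symbols \<Longrightarrow> (\<lambda>x \<xi>. g x * P x \<xi>) \<in> symbols"
  unfolding symbols_iff using has_symbol_mult by blast

lemma symbols_cmult: "P \<in> symbols \<Longrightarrow> (\<lambda>x \<xi>. c * P x \<xi>) \<in> symbols"
  using symbols_mult[of "\<lambda>_. c"] by simp

lemma symbols_xi_mult: "P \<in> symbols \<Longrightarrow> (\<lambda>x \<xi>. \<xi> $ k $ i * P x \<xi>) \<in> symbols"
  unfolding symbols_iff using has_symbol_slot_partial by blast

text \<open>
  The operator \<open>x\<^sup>i + D\<^bsub>\<xi>\<^sup>k\<^sub>i\<^esub>\<close> preserves symbols because it comes from an operation on operators; subtracting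
  the multiplication by \<open>x\<^sup>i\<close> isolates the derivative.  The same device works for \<open>dx\<close>.
\<close>

lemma symbols_D_xi: "P \<in> symbols \<Longrightarrow> D_xi k i P \<in> symbols"
proof -
  assume P: "P \<in> symbols"
  then have "(\<lambda>x \<xi>. x $ i * P x \<xi> + D_xi k i P x \<xi>) \<in> symbols"
    unfolding symbols_iff using has_symbol_slot_coord by blast
  from symbols_diff[OF this symbols_mult[OF smooth_coord[of i] P]]
  show ?thesis by (simp add: fun_diff_def)
qed

lemma symbols_dx: "P \<in> symbols \<Longrightarrow> dx i P \<in> symbols"
proof -
  assume P: "P \<in> symbols"
  then have "dx i P + (\<Sum>k\<in>UNIV. (\<lambda>x \<xi>. \<xi> $ k $ i * P x \<xi>)) \<in> symbols"
    unfolding symbols_iff using has_symbol_partial by blast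
  moreover have "(\<Sum>k\<in>UNIV. (\<lambda>x \<xi>. \<xi> $ k $ i * P x \<xi>)) \<in> symbols"
    by (intro symbols_sum symbols_xi_mult P)
  ultimately have "(dx i P + (\<Sum>k\<in>UNIV. (\<lambda>x \<xi>. \<xi> $ k $ i * P x \<xi>)))
      - (\<Sum>k\<in>UNIV. (\<lambda>x \<xi>. \<xi> $ k $ i * P x \<xi>)) \<in> symbols"
    by (rule symbols_diff)
  then show ?thesis by (simp only: add_diff_cancel_right')
qed

lemmas symbols_intros = symbols_zero symbols_add symbols_uminus symbols_diff symbols_sum
  symbols_mult symbols_cmult symbols_xi_mult symbols_D_xi symbols_dx

lemma dx_add: "P \<in> symbols \<Longrightarrow> Q \<in> symbols \<Longrightarrow> dx i (P + Q) = dx i P + dx i Q"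
  unfolding symbols_iff using has_symbol_dx_add by blast

lemma D_xi_add: "P \<in> symbols \<Longrightarrow> Q \<in> symbols \<Longrightarrow> D_xi k i (P + Q) = D_xi k i P + D_xi k i Q"
  unfolding symbols_iff using has_symbol_D_xi_add by blast

lemma dx_mult:
  assumes "smooth g" "P \<in> symbols"
  shows "dx i (\<lambda>x \<xi>. g x * P x \<xi>) x \<xi> = g x * dx i P x \<xi> + partial i g x * P x \<xi>"
  using assms unfolding symbols_iff
  by (auto simp: dx_def partial_mult symbol_smooth smooth_differentiable)

lemma dx_xi_mult:
  "P \<in> symbols \<Longrightarrow> dx i (\<lambda>x \<xi>. \<xi> $ k $ j * P x \<xi>) x \<xi> = \<xi> $ k $ j * dx i P x \<xi>"
  unfolding symbols_iff by (auto simp: dx_def partial_cmult symbol_smooth smooth_differentiable)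

lemma D_xi_mult:
  assumes "P \<in> symbols"
  shows "D_xi k i (\<lambda>x \<xi>. g x * P x \<xi>) x \<xi> = g x * D_xi k i P x \<xi>"
proof -
  obtain P' where "(P x has_derivative P') (at \<xi>)"
    using assms symbol_differentiable unfolding symbols_iff differentiable_def by blast
  then show ?thesis
    using D_xi_eq[of "\<lambda>x \<xi>. g x * P x \<xi>" x "\<lambda>h. g x * P' h" \<xi> k i] by (simp add: D_xi_eq has_derivative_mult_right)
qed

lemma D_xi_xi_mult:
  assumes "P \<in> symbols"
  shows "D_xi k i (\<lambda>x \<xi>. \<xi> $ l $ j * P x \<xi>) x \<xi>
    = \<xi> $ l $ j * D_xi k i P x \<xi> + (if k = l \<and> i = j then P x \<xi> else 0)"
proof -
  obtain P' where P': "(P x has_derivative P') (at \<xi>)"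
    using assms symbol_differentiable unfolding symbols_iff differentiable_def by blast
  have "((\<lambda>\<xi>. \<xi> $ l $ j) has_derivative (\<lambda>h. h $ l $ j)) (at \<xi>)"
    by (intro bounded_linear_imp_has_derivative
        bounded_linear_compose[OF bounded_linear_vec_nth bounded_linear_vec_nth])
  from D_xi_eq[of "\<lambda>x \<xi>. \<xi> $ l $ j * P x \<xi>", OF has_derivative_mult[OF this P'], of k i]
  show ?thesis using D_xi_eq[of P, OF P'] by (auto simp: axis_def)
qed

lemma dx_D_xi: "P \<in> symbols \<Longrightarrow> dx i (D_xi k j P) = D_xi k j (dx i P)"
proof -
  assume "P \<in> symbols"
  then obtain T where "has_symbol T P" unfolding symbols_iff by blast
  then show ?thesis
  proof (induction rule: has_symbol.induct)
    case zero
    show ?case by (simp add: fun_eq_iff dx_def D_xi_def zero_fun_def)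
  next
    case (add T P U Q)
    then have S: "P \<in> symbols" "Q \<in> symbols" unfolding symbols_iff by blast+
    show ?case
      unfolding D_xi_add[OF S] dx_add[OF S] dx_add[OF S[THEN symbols_D_xi]]
        D_xi_add[OF S[THEN symbols_dx]] add.IH ..
  next
    case (mono A a)
    have "smooth (\<lambda>x. real (a k j) * A x)" using mono by (simp add: smooth_mult)
    moreover have "partial i (\<lambda>x. real (a k j) * A x) = (\<lambda>x. real (a k j) * partial i A x)"
      using mono by (simp add: fun_eq_iff partial_cmult smooth_differentiable)
    ultimately show ?case
      using mono by (simp only: D_xi_mono_symb dx_mono_symb smooth_partial)
  qed
qed

section \<open>Cancellation in the Casimir sum\<close>

definition additive_on :: "'v::ab_group_add set \<Rightarrow> ('v \<Rightarrow> 'v) \<Rightarrow> bool" where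
  "additive_on S f \<longleftrightarrow> (\<forall>u\<in>S. \<forall>v\<in>S. f (u + v) = f u + f v)"

lemma additive_on_rules:
  assumes zero: "0 \<in> S" and diff: "\<forall>u\<in>S. \<forall>v\<in>S. u - v \<in> S" and add: "additive_on S f"
  shows "f 0 = 0"
    and "u \<in> S \<Longrightarrow> f (- u) = - f u"
    and "u \<in> S \<Longrightarrow> v \<in> S \<Longrightarrow> f (u - v) = f u - f v"
    and "(\<And>i. i \<in> I \<Longrightarrow> g i \<in> S) \<Longrightarrow> f (\<Sum>i\<in>I. g i) = (\<Sum>i\<in>I. f (g i))"
proof -
  have S: "0 \<in> S" "\<And>u v. u \<in> S \<Longrightarrow> v \<in> S \<Longrightarrow> u - v \<in> S"
    using zero diff by blast+
  have f: "f (u + v) = f u + f v" if "u \<in> S" "v \<in> S" for u v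
    using add that by (simp add: additive_on_def)
  show 0: "f 0 = 0" using f[OF S(1) S(1)] by simp
  have uminus: "- u \<in> S" if "u \<in> S" for u using S(2)[OF S(1) that] by simp
  have add: "u + v \<in> S" if "u \<in> S" "v \<in> S" for u v using S(2)[OF that(1) uminus[OF that(2)]] by simp
  show neg: "f (- u) = - f u" if "u \<in> S" for u
    using f[OF that uminus[OF that]] 0 by (simp add: eq_neg_iff_add_eq_0 add.commute)
  show "f (u - v) = f u - f v" if "u \<in> S" "v \<in> S"
    using f[OF that(1) uminus[OF that(2)]] neg[OF that(2)] by simp
  have "f (\<Sum>i\<in>I. g i) = (\<Sum>i\<in>I. f (g i)) \<and> (\<Sum>i\<in>I. g i) \<in> S" if "\<And>i. i \<in> I \<Longrightarrow> g i \<in> S"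
    using that
  proof (induction I rule: infinite_finite_induct)
    case (insert i I)
    then show ?case by (simp add: f add)
  qed (simp_all add: 0 S(1))
  then show "(\<And>i. i \<in> I \<Longrightarrow> g i \<in> S) \<Longrightarrow> f (\<Sum>i\<in>I. g i) = (\<Sum>i\<in>I. f (g i))" by blast
qed

text \<open>
  The computation behind the Casimir operator on symbols, in a form that only uses commutation rules.
  The \<open>x i\<close> and \<open>d i\<close> satisfy the relations of coordinates and derivatives, and the operators \<open>B i j\<close> commute
  with both; they play the part of the action of \<open>gl\<^sub>n\<close> on the fibres.  The operators \<open>N i j\<close> and \<open>F i\<close> then
  have the form of the Lie derivatives along \<open>x\<^sup>j \<partial>\<^sub>i\<close> and \<open>\<epsilon>\<^sup>i\<close>.  In the Casimir sum all terms that contain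
  \<open>x\<close> cancel.  Reordering \<open>d i\<close> past the \<open>x\<close> factors of \<open>F i\<close> leaves \<open>n + 1\<close> copies of the trace of \<open>B\<close>;
  they appear here as a double sum and a single sum because no scalars are available in \<open>'v\<close>.
\<close>

lemma casimir_algebra:
  fixes x d :: "'n::finite \<Rightarrow> 'v::ab_group_add \<Rightarrow> 'v" and B :: "'n \<Rightarrow> 'n \<Rightarrow> 'v \<Rightarrow> 'v"
  assumes zero: "0 \<in> S" and diff: "\<forall>u\<in>S. \<forall>v\<in>S. u - v \<in> S"
    and x_closed: "\<And>i u. u \<in> S \<Longrightarrow> x i u \<in> S"
    and d_closed: "\<And>i u. u \<in> S \<Longrightarrow> d i u \<in> S"
    and B_closed: "\<And>i j u. u \<in> S \<Longrightarrow> B i j u \<in> S"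
    and x_additive: "\<And>i. additive_on S (x i)"
    and d_additive: "\<And>i. additive_on S (d i)"
    and B_additive: "\<And>i j. additive_on S (B i j)"
    and x_x: "\<And>i j u. u \<in> S \<Longrightarrow> x i (x j u) = x j (x i u)"
    and d_x: "\<And>i j u. u \<in> S \<Longrightarrow> d i (x j u) = x j (d i u) + (if i = j then u else 0)"
    and B_x: "\<And>i j k u. u \<in> S \<Longrightarrow> B i j (x k u) = x k (B i j u)"
    and B_d: "\<And>i j k u. u \<in> S \<Longrightarrow> B i j (d k u) = d k (B i j u)"
    and N: "\<And>i j u. N i j u = x j (d i u) - B i j u"
    and F: "\<And>i u. F i u = x i (\<Sum>r\<in>UNIV. x r (d r u)) - (\<Sum>r\<in>UNIV. x r (B r i u)) - x i (\<Sum>r\<in>UNIV. B r r u)"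
    and v: "v \<in> S"
  shows "(\<Sum>i\<in>UNIV. \<Sum>j\<in>UNIV. N i j (N j i v)) + (\<Sum>k\<in>UNIV. \<Sum>i\<in>UNIV. N k k (N i i v))
      - (\<Sum>i\<in>UNIV. d i (F i v)) - (\<Sum>i\<in>UNIV. F i (d i v))
    = (\<Sum>i\<in>UNIV. \<Sum>j\<in>UNIV. B i j (B j i v)) + (\<Sum>k\<in>UNIV. \<Sum>i\<in>UNIV. B k k (B i i v))
      + (\<Sum>j\<in>(UNIV::'n set). \<Sum>i\<in>UNIV. B i i v) + (\<Sum>i\<in>UNIV. B i i v)"
proof -
  have diff': "u - w \<in> S" if "u \<in> S" "w \<in> S" for u w
    using diff that by blast
  have add: "u + w \<in> S" if "u \<in> S" "w \<in> S" for u w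
    using diff'[OF that(1) diff'[OF zero that(2)]] by simp
  have sum: "(\<Sum>i\<in>I. g i) \<in> S" if "\<And>i. g i \<in> S" for g :: "'n \<Rightarrow> 'v" and I
    by (induction I rule: infinite_finite_induct) (auto intro: zero add that)
  note closed = v zero diff' add sum x_closed d_closed B_closed
  have x_add: "x i (u + w) = x i u + x i w" and d_add: "d i (u + w) = d i u + d i w"
    if "u \<in> S" "w \<in> S" for i u w
    using x_additive d_additive that by (auto simp: additive_on_def)
  note x_lin = additive_on_rules[OF zero diff x_additive]
  note d_lin = additive_on_rules[OF zero diff d_additive]
  note B_lin = additive_on_rules[OF zero diff B_additive]
  have 1: "N i j (N j i v) = x j (x i (d i (d j v))) + x j (d j v) - x j (d i (B j i v))
      - x i (d j (B i j v)) + B i j (B j i v)" for i j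
    by (simp add: N closed x_lin d_lin B_lin x_add d_add d_x B_x B_d)
  have 2: "N k k (N i i v) = x k (x i (d k (d i v))) + (if k = i then x k (d i v) else 0)
      - x k (d k (B i i v)) - x i (d i (B k k v)) + B k k (B i i v)" for k i
    by (simp add: N closed x_lin d_lin B_lin x_add d_add d_x B_x B_d)
  have 3: "d i (F i v) = (\<Sum>r\<in>UNIV. x i (x r (d i (d r v))) + (if i = r then x i (d r v) else 0) + x r (d r v)
      - x r (d i (B r i v)) - (if i = r then B r i v else 0) - x i (d i (B r r v)) - B r r v)" for i
    by (simp add: F closed x_lin d_lin x_add d_add d_x sum.distrib sum_subtractf
        if_distrib[where f = "x i"] cong: if_cong)
  have 4: "F i (d i v) = (\<Sum>r\<in>UNIV. x i (x r (d r (d i v))) - x r (d i (B r i v)) - x i (d i (B r r v)))" for i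
    by (simp add: F closed x_lin d_lin x_add d_add B_d sum_subtractf)
  \<comment> \<open>The remaining differences are only in the names of summation indices and in the order of two factors \<open>x\<close>.\<close>
  have s1: "(\<Sum>i\<in>UNIV. \<Sum>j\<in>UNIV. x i (d j (B i j v))) = (\<Sum>i\<in>UNIV. \<Sum>j\<in>UNIV. x j (d i (B j i v)))"
    by (rule sum.swap)
  have s2: "(\<Sum>k\<in>UNIV. \<Sum>i\<in>UNIV. x i (d i (B k k v))) = (\<Sum>k\<in>UNIV. \<Sum>i\<in>UNIV. x k (d k (B i i v)))"
    by (rule sum.swap)
  have s3: "(\<Sum>i\<in>UNIV. \<Sum>r\<in>UNIV. x i (x r (d r (d i v)))) = (\<Sum>i\<in>UNIV. \<Sum>r\<in>UNIV. x i (x r (d i (d r v))))"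
    by (subst sum.swap) (simp add: x_x closed)
  have s4: "(\<Sum>i\<in>UNIV. \<Sum>j\<in>UNIV. x j (x i (d i (d j v)))) = (\<Sum>i\<in>UNIV. \<Sum>r\<in>UNIV. x i (x r (d i (d r v))))"
    by (simp add: x_x closed)
  show ?thesis
    unfolding 1 2 3 4 sum.distrib sum_subtractf s1 s2 s3 s4 by (simp add: algebra_simps)
qed

section \<open>Lie derivatives of symbols\<close>

lemma symbols_subgroup: "\<forall>P\<in>symbols. \<forall>Q\<in>symbols. P - Q \<in> symbols"
  by (intro ballI symbols_diff)

lemma additive_on_dx: "additive_on symbols (dx i)"
  and additive_on_D_xi: "additive_on symbols (D_xi k i)"
  by (simp_all add: additive_on_def dx_add D_xi_add)

lemmas dx_rules = additive_on_rules[OF symbols_zero symbols_subgroup additive_on_dx]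
lemmas D_xi_rules = additive_on_rules[OF symbols_zero symbols_subgroup additive_on_D_xi]

definition x_mult :: "'n::finite \<Rightarrow> ('n, 'p::finite) symb \<Rightarrow> ('n, 'p) symb" where
  "x_mult i P x \<xi> = x $ i * P x \<xi>"

lemma x_mult_eq: "x_mult i P = (\<lambda>x \<xi>. x $ i * P x \<xi>)"
  by (simp add: fun_eq_iff x_mult_def)

text \<open>
  The action on fibres of the matrix unit in row \<open>i\<close> and column \<open>j\<close>, with the density term absorbed into the diagonal:
  a vector field enters \<open>lie_symbol\<close> only through its value and its Jacobian matrix, and the divergence is
  the trace of the latter.  With this choice the weight \<open>\<delta>\<close> disappears from all later computations
  until \<open>gl_act\<close> is expanded again.
\<close>

definition gl_act :: "real \<Rightarrow> 'n::finite \<Rightarrow> 'n \<Rightarrow> ('n, 'p::finite) symb \<Rightarrow> ('n, 'p) symb" where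
  "gl_act \<delta> i j P x \<xi> = (\<Sum>k\<in>UNIV. \<xi> $ k $ i * D_xi k j P x \<xi>) - (if i = j then \<delta> * P x \<xi> else 0)"

text \<open>
  The Lie derivative of symbols along \<open>x\<^sup>j \<partial>\<^sub>i\<close>.
\<close>

definition gl_lie :: "real \<Rightarrow> 'n::finite \<Rightarrow> 'n \<Rightarrow> ('n, 'p::finite) symb \<Rightarrow> ('n, 'p) symb" where
  "gl_lie \<delta> i j P = x_mult j (dx i P) - gl_act \<delta> i j P"

lemma gl_act_eq:
  "gl_act \<delta> i j P = (\<Sum>k\<in>UNIV. (\<lambda>x \<xi>. \<xi> $ k $ i * D_xi k j P x \<xi>))
    - (\<lambda>x \<xi>. (if i = j then \<delta> else 0) * P x \<xi>)"
  by (simp add: fun_eq_iff gl_act_def sum_fun_apply)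

lemma symbols_gl_act: "P \<in> symbols \<Longrightarrow> gl_act \<delta> i j P \<in> symbols"
  unfolding gl_act_eq by (intro symbols_diff symbols_sum symbols_xi_mult symbols_D_xi symbols_cmult)

lemma symbols_x_mult: "P \<in> symbols \<Longrightarrow> x_mult i P \<in> symbols"
  unfolding x_mult_eq by (intro symbols_mult smooth_coord)

lemma symbols_gl_lie: "P \<in> symbols \<Longrightarrow> gl_lie \<delta> i j P \<in> symbols"
  unfolding gl_lie_def by (intro symbols_diff symbols_x_mult symbols_gl_act symbols_dx)

lemma x_mult_add: "x_mult i (P + Q) = x_mult i P + x_mult i Q"
  by (simp add: fun_eq_iff x_mult_def algebra_simps)

lemma additive_on_x_mult: "additive_on symbols (x_mult i)"
  by (simp add: additive_on_def x_mult_add)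

lemma additive_on_gl_act: "additive_on symbols (gl_act \<delta> i j)"
  unfolding additive_on_def
proof (intro ballI ext)
  fix P Q :: "('a, 'b) symb" and x \<xi>
  assume "P \<in> symbols" "Q \<in> symbols"
  then show "gl_act \<delta> i j (P + Q) x \<xi> = (gl_act \<delta> i j P + gl_act \<delta> i j Q) x \<xi>"
    by (simp add: gl_act_def D_xi_add algebra_simps sum.distrib)
qed

lemma additive_on_gl_lie: "additive_on symbols (gl_lie \<delta> i j)"
  using additive_on_gl_act[of \<delta> i j]
  by (auto simp: additive_on_def gl_lie_def dx_add x_mult_add)

lemma x_mult_uminus: "x_mult i (- P) = - x_mult i P"
  by (simp add: fun_eq_iff x_mult_def)

lemmas gl_act_rules = additive_on_rules[OF symbols_zero symbols_subgroup additive_on_gl_act]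
lemmas gl_lie_rules = additive_on_rules[OF symbols_zero symbols_subgroup additive_on_gl_lie]

lemma x_mult_commute: "x_mult i (x_mult j P) = x_mult j (x_mult i P)"
  by (simp add: fun_eq_iff x_mult_def)

lemma dx_x_mult:
  "P \<in> symbols \<Longrightarrow> dx i (x_mult j P) = x_mult j (dx i P) + (if i = j then P else 0)"
  by (simp add: fun_eq_iff x_mult_eq dx_mult)

lemma gl_act_x_mult: "P \<in> symbols \<Longrightarrow> gl_act \<delta> i j (x_mult k P) = x_mult k (gl_act \<delta> i j P)"
  by (simp add: fun_eq_iff gl_act_def x_mult_eq D_xi_mult sum_distrib_left algebra_simps)

lemma gl_act_dx:
  assumes P: "P \<in> symbols"
  shows "gl_act \<delta> i j (dx l P) = dx l (gl_act \<delta> i j P)"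
proof -
  have "dx l (gl_act \<delta> i j P) = (\<Sum>k\<in>UNIV. dx l (\<lambda>x \<xi>. \<xi> $ k $ i * D_xi k j P x \<xi>))
      - dx l (\<lambda>x \<xi>. (if i = j then \<delta> else 0) * P x \<xi>)"
    unfolding gl_act_eq
    by (subst dx_rules(3), (intro symbols_intros P)+, subst dx_rules(4), (intro symbols_intros P)+) (rule refl)
  then show ?thesis
    by (simp add: fun_eq_iff gl_act_def sum_fun_apply dx_mult[OF smooth_const] dx_xi_mult P
        symbols_D_xi dx_D_xi)
qed

lemma lie_symbol_eq:
  "lie_symbol \<delta> X P x \<xi> = (\<Sum>a\<in>UNIV. X x $ a * dx a P x \<xi>)
    - (\<Sum>a\<in>UNIV. \<Sum>b\<in>UNIV. partial b (\<lambda>y. X y $ a) x * gl_act \<delta> a b P x \<xi>)"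
proof -
  let ?M = "\<lambda>a b. partial b (\<lambda>y. X y $ a) x"
  have "(\<Sum>k\<in>UNIV. \<Sum>a\<in>UNIV. \<Sum>b\<in>UNIV. ?M a b * \<xi> $ k $ a * D_xi k b P x \<xi>)
      = (\<Sum>a\<in>UNIV. \<Sum>k\<in>UNIV. \<Sum>b\<in>UNIV. ?M a b * \<xi> $ k $ a * D_xi k b P x \<xi>)"
    by (rule sum.swap)
  also have "\<dots> = (\<Sum>a\<in>UNIV. \<Sum>b\<in>UNIV. ?M a b * (\<Sum>k\<in>UNIV. \<xi> $ k $ a * D_xi k b P x \<xi>))"
    by (intro sum.cong refl trans[OF sum.swap]) (simp add: sum_distrib_left mult.assoc)
  finally have "(\<Sum>k\<in>UNIV. \<Sum>a\<in>UNIV. \<Sum>b\<in>UNIV. ?M a b * \<xi> $ k $ a * D_xi k b P x \<xi>) = \<dots>" .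
  moreover have "(\<Sum>a\<in>UNIV. \<Sum>b\<in>UNIV. ?M a b * (if a = b then \<delta> * P x \<xi> else 0))
      = \<delta> * divergence X x * P x \<xi>"
    by (simp add: divergence_def if_distrib[where f = "\<lambda>t. _ * t"] sum_distrib_left sum_distrib_right
        mult_ac cong: if_cong)
  ultimately show ?thesis
    unfolding lie_symbol_def by (simp add: dx_def gl_act_def right_diff_distrib sum_subtractf)
qed

definition affine_field :: "('n::finite \<Rightarrow> 'n \<Rightarrow> real) \<Rightarrow> ('n \<Rightarrow> real) \<Rightarrow> real^'n \<Rightarrow> real^'n" where
  "affine_field m c x = (\<chi> a. c a + (\<Sum>b\<in>UNIV. m a b * x $ b))"

lemma partial_affine_field: "partial b (\<lambda>y. affine_field m c y $ a) x = m a b"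
proof -
  have "partial b (\<lambda>y. c a + (\<Sum>j\<in>UNIV. m a j * y $ j)) x
    = (\<Sum>j\<in>UNIV. partial b (\<lambda>y. m a j * y $ j) x)"
    by (subst partial_add)
      (auto intro!: smooth_differentiable smooth_intros simp: partial_sum)
  then show ?thesis
    by (simp add: affine_field_def partial_cmult if_distrib[where f = "\<lambda>t. _ * t"] cong: if_cong)
qed

lemma divergence_affine_field: "divergence (affine_field m c) x = (\<Sum>a\<in>UNIV. m a a)"
  by (simp add: divergence_def partial_affine_field)

lemma lie_symbol_affine_field:
  "lie_symbol \<delta> (affine_field m c) P x \<xi>
    = (\<Sum>a\<in>UNIV. c a * dx a P x \<xi>) + (\<Sum>a\<in>UNIV. \<Sum>b\<in>UNIV. m a b * gl_lie \<delta> a b P x \<xi>)"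
  unfolding lie_symbol_eq partial_affine_field
  by (simp add: affine_field_def gl_lie_def x_mult_def algebra_simps sum.distrib sum_subtractf
      sum_distrib_left)

definition matrix_unit :: "'n \<Rightarrow> 'n \<Rightarrow> 'n \<Rightarrow> 'n \<Rightarrow> real" where
  "matrix_unit i j a b = (if a = i \<and> b = j then 1 else 0)"

lemma sum_matrix_unit:
  "(\<Sum>a\<in>UNIV. \<Sum>b\<in>UNIV. matrix_unit i j a b * f a b) = (f (i::'n::finite) j :: real)"
proof -
  have "(\<Sum>a\<in>UNIV. \<Sum>b\<in>UNIV. matrix_unit i j a b * f a b)
    = (\<Sum>a\<in>UNIV. if a = i then (\<Sum>b\<in>UNIV. if b = j then f a b else 0) else 0)"
  proof (intro sum.cong refl)
    fix a
    show "(\<Sum>b\<in>UNIV. matrix_unit i j a b * f a b) = (if a = i then (\<Sum>b\<in>UNIV. if b = j then f a b else 0) else 0)"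
      by (cases "a = i") (simp_all add: matrix_unit_def if_distrib[where f = "\<lambda>t. t * _"] cong: if_cong)
  qed
  also have "\<dots> = f i j" by simp
  finally show ?thesis .
qed

lemma sum_matrix_unit_row: "(\<Sum>b\<in>UNIV. matrix_unit i j a b * f b) = (if a = i then f (j::'n::finite) else (0::real))"
  by (auto simp: matrix_unit_def if_distrib[where f = "\<lambda>t. t * _"] cong: if_cong)

lemma e_mat_affine:
  "i \<noteq> j \<Longrightarrow> e_mat i j = affine_field (\<lambda>a b. - matrix_unit i j a b) (\<lambda>_. 0)"
  "e_mat i i = affine_field (\<lambda>a b. - matrix_unit i i a b - (\<Sum>k\<in>UNIV. matrix_unit k k a b)) (\<lambda>_. 0)"
  "e_mat_dual i i = affine_field (\<lambda>a b. - matrix_unit i i a b) (\<lambda>_. 0)"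
  "e_vec i = affine_field (\<lambda>_ _. 0) (\<lambda>a. if a = i then -1 else 0)"
proof -
  have "(\<Sum>b\<in>UNIV. (\<Sum>k\<in>UNIV. matrix_unit k k a b) * x $ b) = x $ a" for a and x :: "real^'a"
    by (subst sum_distrib_right, subst sum.swap) (simp add: sum_matrix_unit_row)
  then show "e_mat i i = affine_field (\<lambda>a b. - matrix_unit i i a b - (\<Sum>k\<in>UNIV. matrix_unit k k a b)) (\<lambda>_. 0)"
    by (auto simp: fun_eq_iff vec_eq_iff e_mat_def affine_field_def left_diff_distrib sum_subtractf
        sum_negf sum_matrix_unit_row axis_def)
qed (auto simp: fun_eq_iff vec_eq_iff e_mat_def e_mat_dual_def e_vec_def affine_field_def sum_negf
      sum_matrix_unit_row axis_def)

lemma lie_symbol_e_mat: "i \<noteq> j \<Longrightarrow> lie_symbol \<delta> (e_mat i j) P = - gl_lie \<delta> i j P"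
  by (simp add: fun_eq_iff e_mat_affine lie_symbol_affine_field sum_negf sum_matrix_unit)

lemma lie_symbol_e_mat_diag:
  "lie_symbol \<delta> (e_mat i i) P = - gl_lie \<delta> i i P - (\<Sum>k\<in>UNIV. gl_lie \<delta> k k P)"
proof -
  have "(\<Sum>a\<in>UNIV. \<Sum>b\<in>UNIV. (\<Sum>k\<in>UNIV. matrix_unit k k a b) * f a b) = (\<Sum>k\<in>UNIV. f k k :: real)"
    for f :: "'a \<Rightarrow> 'a \<Rightarrow> real"
  proof -
    have "(\<Sum>a\<in>UNIV. \<Sum>b\<in>UNIV. (\<Sum>k\<in>UNIV. matrix_unit k k a b) * f a b)
      = (\<Sum>a\<in>UNIV. \<Sum>k\<in>UNIV. \<Sum>b\<in>UNIV. matrix_unit k k a b * f a b)"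
      unfolding sum_distrib_right by (intro sum.cong refl sum.swap)
    also have "\<dots> = (\<Sum>k\<in>UNIV. \<Sum>a\<in>UNIV. \<Sum>b\<in>UNIV. matrix_unit k k a b * f a b)"
      by (rule sum.swap)
    finally show ?thesis by (simp add: sum_matrix_unit)
  qed
  then show ?thesis
    by (simp add: fun_eq_iff e_mat_affine lie_symbol_affine_field sum_negf sum_matrix_unit
        left_diff_distrib sum_subtractf sum_fun_apply)
qed

lemma lie_symbol_e_mat_dual_diag: "lie_symbol \<delta> (e_mat_dual i i) P = - gl_lie \<delta> i i P"
  by (simp add: fun_eq_iff e_mat_affine lie_symbol_affine_field sum_negf sum_matrix_unit)

lemma lie_symbol_e_vec: "lie_symbol \<delta> (e_vec i) P = - dx i P"
  by (simp add: fun_eq_iff e_mat_affine lie_symbol_affine_field if_distrib[where f = "\<lambda>t. t * _"]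
      cong: if_cong)

lemma partial_eps_vec:
  "partial b (\<lambda>y. eps_vec i y $ a) x = (if b = i then x $ a else 0) + (if b = a then x $ i else 0)"
  by (simp add: eps_vec_def partial_mult)

lemma divergence_eps_vec: "divergence (eps_vec i) (x::real^'n::finite) = (real CARD('n) + 1) * x $ i"
  by (simp add: divergence_def partial_eps_vec sum.distrib algebra_simps)

lemma lie_symbol_eps_vec:
  "lie_symbol \<delta> (eps_vec i) P = x_mult i (\<Sum>r\<in>UNIV. x_mult r (dx r P))
    - (\<Sum>r\<in>UNIV. x_mult r (gl_act \<delta> r i P)) - x_mult i (\<Sum>r\<in>UNIV. gl_act \<delta> r r P)"
proof (intro ext)
  fix x \<xi>
  have "(\<Sum>b\<in>UNIV. partial b (\<lambda>y. eps_vec i y $ a) x * gl_act \<delta> a b P x \<xi>)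
    = x $ a * gl_act \<delta> a i P x \<xi> + x $ i * gl_act \<delta> a a P x \<xi>" for a
    by (simp add: partial_eps_vec distrib_right sum.distrib if_distrib[where f = "\<lambda>t. t * _"]
        cong: if_cong)
  then show "lie_symbol \<delta> (eps_vec i) P x \<xi> = (x_mult i (\<Sum>r\<in>UNIV. x_mult r (dx r P))
    - (\<Sum>r\<in>UNIV. x_mult r (gl_act \<delta> r i P)) - x_mult i (\<Sum>r\<in>UNIV. gl_act \<delta> r r P)) x \<xi>"
    unfolding lie_symbol_eq
    by (simp add: eps_vec_def x_mult_def sum_fun_apply sum.distrib sum_distrib_left mult.assoc)
qed

section \<open>The Casimir operator on symbols\<close>

text \<open>
  The basis of the Casimir sum treats \<open>i = j\<close> separately; the extra terms on the diagonal produce the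
  square of the trace, and the remaining ones complete the double sum.
\<close>

lemma sum_off_diagonal:
  fixes f :: "'n::finite \<Rightarrow> 'n \<Rightarrow> 'v::ab_group_add"
  shows "(\<Sum>(i, j)\<in>{(i, j). i \<noteq> j}. f i j) + (\<Sum>i\<in>UNIV. f i i) = (\<Sum>i\<in>UNIV. \<Sum>j\<in>UNIV. f i j)"
proof -
  have "(\<Sum>i\<in>UNIV. f i i) = (\<Sum>(i, j)\<in>{(i, j). i = j}. f i j)"
    by (rule sum.reindex_bij_witness[of _ fst "\<lambda>i. (i, i)"]) auto
  moreover have "(\<Sum>(i, j)\<in>{(i, j). i \<noteq> j} \<union> {(i, j). i = j}. f i j)
      = (\<Sum>(i, j)\<in>{(i, j). i \<noteq> j}. f i j) + (\<Sum>(i, j)\<in>{(i, j). i = j}. f i j)"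
    by (rule sum.union_disjoint) auto
  moreover have "{(i, j). i \<noteq> j} \<union> {(i, j). i = j} = (UNIV :: ('n \<times> 'n) set)" by auto
  ultimately show ?thesis
    by (simp only: sum.cartesian_product UNIV_Times_UNIV)
qed

text \<open>
  Normal ordering: \<open>D_xi k j\<close> is moved past \<open>\<xi>\<^sup>l\<^sub>a\<close>, which costs the term with \<open>j = a\<close>.
\<close>

lemma gl_act_gl_act:
  assumes P: "P \<in> symbols"
  shows "gl_act \<delta> i j (gl_act \<delta> a b P) x \<xi>
    = (\<Sum>k\<in>UNIV. \<Sum>l\<in>UNIV. \<xi> $ k $ i * \<xi> $ l $ a * D_xi k j (D_xi l b P) x \<xi>)
      + (if j = a then (\<Sum>k\<in>UNIV. \<xi> $ k $ i * D_xi k b P x \<xi>) else 0)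
      - (if a = b then \<delta> * (\<Sum>k\<in>UNIV. \<xi> $ k $ i * D_xi k j P x \<xi>) else 0)
      - (if i = j then \<delta> * (\<Sum>k\<in>UNIV. \<xi> $ k $ a * D_xi k b P x \<xi>) else 0)
      + (if i = j then if a = b then \<delta> * \<delta> * P x \<xi> else 0 else 0)"
proof -
  have *: "D_xi k j (gl_act \<delta> a b P) x \<xi>
      = (\<Sum>l\<in>UNIV. \<xi> $ l $ a * D_xi k j (D_xi l b P) x \<xi>)
        + (if j = a then D_xi k b P x \<xi> else 0) - (if a = b then \<delta> * D_xi k j P x \<xi> else 0)" for k
  proof -
    have "D_xi k j (gl_act \<delta> a b P) = (\<Sum>l\<in>UNIV. D_xi k j (\<lambda>x \<xi>. \<xi> $ l $ a * D_xi l b P x \<xi>))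
        - D_xi k j (\<lambda>x \<xi>. (if a = b then \<delta> else 0) * P x \<xi>)"
      unfolding gl_act_eq
      by (subst D_xi_rules(3), (intro symbols_intros P)+, subst D_xi_rules(4), (intro symbols_intros P)+)
        (rule refl)
    then show ?thesis
      by (simp add: sum_fun_apply D_xi_xi_mult D_xi_mult[OF P] symbols_D_xi P sum.distrib)
  qed
  show ?thesis
    unfolding gl_act_def[of \<delta> i j] * gl_act_def[of \<delta> a b]
    by (simp add: algebra_simps sum.distrib sum_subtractf sum_distrib_left)
qed

lemma casimir_lie_symbol_gl:
  assumes P: "P \<in> symbols"
  shows "casimir (lie_symbol \<delta>) P
    = (\<Sum>i\<in>UNIV. \<Sum>j\<in>UNIV. gl_act \<delta> i j (gl_act \<delta> j i P)) + (\<Sum>k\<in>UNIV. \<Sum>i\<in>UNIV. gl_act \<delta> k k (gl_act \<delta> i i P))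
      + (\<Sum>j\<in>(UNIV::'n set). \<Sum>i\<in>UNIV. gl_act \<delta> i i P) + (\<Sum>i\<in>UNIV. gl_act \<delta> i (i::'n::finite) P)"
proof -
  let ?N = "gl_lie \<delta>" and ?F = "\<lambda>i. lie_symbol \<delta> (eps_vec i)"
  have neg: "?N i j (- ?N a b P) = - ?N i j (?N a b P)" for i j a b
    by (rule gl_lie_rules(2)) (intro symbols_gl_lie P)
  have F_neg: "?F i (- dx i P) = - ?F i (dx i P)" for i
    using P by (simp add: lie_symbol_eps_vec dx_rules(2) gl_act_rules(2) symbols_dx x_mult_uminus sum_negf)
  have off: "lie_symbol \<delta> (e_mat i j) (lie_symbol \<delta> (e_mat_dual i j) P) = ?N i j (?N j i P)" if "i \<noteq> j" for i j
    using that by (simp add: e_mat_dual_def lie_symbol_e_mat neg)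
  have diag: "lie_symbol \<delta> (e_mat i i) (lie_symbol \<delta> (e_mat_dual i i) P)
      = ?N i i (?N i i P) + (\<Sum>k\<in>UNIV. ?N k k (?N i i P))" for i
    by (simp add: lie_symbol_e_mat_diag lie_symbol_e_mat_dual_diag neg sum_negf)
  have "casimir (lie_symbol \<delta>) P = (\<Sum>(i, j)\<in>{(i, j). i \<noteq> j}. ?N i j (?N j i P))
      + (\<Sum>i\<in>UNIV. ?N i i (?N i i P) + (\<Sum>k\<in>UNIV. ?N k k (?N i i P)) - dx i (?F i P) - ?F i (dx i P))"
    unfolding casimir_def e_vec_dual_def eps_vec_dual_def diag lie_symbol_e_vec F_neg
    by (intro arg_cong2[where f = "(+)"] sum.cong refl) (auto simp: off)
  also have "\<dots> = (\<Sum>i\<in>UNIV. \<Sum>j\<in>UNIV. ?N i j (?N j i P)) + (\<Sum>i\<in>UNIV. \<Sum>k\<in>UNIV. ?N k k (?N i i P))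
      - (\<Sum>i\<in>UNIV. dx i (?F i P)) - (\<Sum>i\<in>UNIV. ?F i (dx i P))"
    unfolding sum_off_diagonal[symmetric] sum.distrib sum_subtractf by (simp only: algebra_simps)
  also have "(\<Sum>i\<in>UNIV. \<Sum>k\<in>UNIV. ?N k k (?N i i P)) = (\<Sum>k\<in>UNIV. \<Sum>i\<in>UNIV. ?N k k (?N i i P))"
    by (rule sum.swap)
  finally show ?thesis
    by (simp only:) (rule casimir_algebra[where S = symbols and x = x_mult and d = dx],
      (rule symbols_zero symbols_subgroup symbols_x_mult symbols_dx symbols_gl_act additive_on_x_mult
        additive_on_dx additive_on_gl_act x_mult_commute dx_x_mult gl_act_x_mult gl_act_dx gl_lie_def lie_symbol_eps_vec P; assumption?)+)
qed

text \<open>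
  Normal ordering of the double sum of \<open>B\<^sub>i\<^sub>j B\<^sub>j\<^sub>i\<close> contributes \<open>n\<close> times the Euler operator \<open>E\<close>, that of the squared trace
  contributes \<open>E\<close>, and the linear term in the trace contributes \<open>(n + 1) E\<close>.  The weight in \<open>B\<^sub>i\<^sub>i\<close>
  contributes \<open>- 2 \<delta> E\<close> and \<open>- 2 n \<delta> E\<close>.  Together this is the term \<open>2 (n + 1) (1 - \<delta>) E\<close> of \<open>C_t\<close>.
\<close>

lemma casimir_lie_symbol:
  fixes P :: "('n::finite, 'p::finite) symb"
  assumes P: "P \<in> symbols"
  shows "casimir (lie_symbol \<delta>) P = C_t \<delta> P"
proof (intro ext)
  fix x :: "real^'n" and \<xi> :: "real^'n^'p"
  let ?n = "real CARD('n)"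
  let ?W = "\<lambda>i j a b. \<Sum>k\<in>UNIV. \<Sum>l\<in>UNIV. \<xi> $ k $ i * \<xi> $ l $ a * D_xi k j (D_xi l b P) x \<xi>"
  define E where "E = (\<Sum>i\<in>UNIV. \<Sum>k\<in>UNIV. \<xi> $ k $ i * D_xi k i P x \<xi>)"
  have E: "(\<Sum>k\<in>UNIV. euler_xi k P x \<xi>) = E"
    unfolding euler_xi_def E_def by (rule sum.swap)
  have tr: "(\<Sum>i\<in>UNIV. gl_act \<delta> i i P x \<xi>) = E - ?n * \<delta> * P x \<xi>"
    by (simp add: gl_act_def E_def sum_subtractf)
  have 1: "(\<Sum>i\<in>UNIV. \<Sum>j\<in>UNIV. gl_act \<delta> i j (gl_act \<delta> j i P) x \<xi>)
      = (\<Sum>i\<in>UNIV. \<Sum>j\<in>UNIV. ?W i j j i) + ?n * E - 2 * \<delta> * E + ?n * \<delta> * \<delta> * P x \<xi>"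
    unfolding gl_act_gl_act[OF P] E_def
    by (simp add: sum.distrib sum_subtractf algebra_simps flip: sum_distrib_left)
  have 2: "(\<Sum>k\<in>UNIV. \<Sum>i\<in>UNIV. gl_act \<delta> k k (gl_act \<delta> i i P) x \<xi>)
      = (\<Sum>i\<in>UNIV. \<Sum>j\<in>UNIV. ?W i i j j) + E - 2 * ?n * \<delta> * E + ?n * ?n * \<delta> * \<delta> * P x \<xi>"
    unfolding gl_act_gl_act[OF P] E_def
    by (simp add: sum.distrib sum_subtractf algebra_simps flip: sum_distrib_left)
  have reorder: "(\<Sum>i\<in>UNIV. \<Sum>j\<in>UNIV. \<Sum>k\<in>UNIV. \<Sum>l\<in>UNIV. f k l i j)
      = (\<Sum>k\<in>UNIV. \<Sum>l\<in>UNIV. \<Sum>i\<in>UNIV. \<Sum>j\<in>UNIV. f k l i j)"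
    for f :: "'p \<Rightarrow> 'p \<Rightarrow> 'n \<Rightarrow> 'n \<Rightarrow> real"
  proof -
    have "(\<Sum>i\<in>UNIV. \<Sum>j\<in>UNIV. \<Sum>k\<in>UNIV. \<Sum>l\<in>UNIV. f k l i j) = (\<Sum>i\<in>UNIV. \<Sum>k\<in>UNIV. \<Sum>j\<in>UNIV. \<Sum>l\<in>UNIV. f k l i j)"
      by (intro sum.cong refl sum.swap)
    also have "\<dots> = (\<Sum>k\<in>UNIV. \<Sum>i\<in>UNIV. \<Sum>j\<in>UNIV. \<Sum>l\<in>UNIV. f k l i j)"
      by (rule sum.swap)
    also have "\<dots> = (\<Sum>k\<in>UNIV. \<Sum>i\<in>UNIV. \<Sum>l\<in>UNIV. \<Sum>j\<in>UNIV. f k l i j)"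
      by (intro sum.cong refl sum.swap)
    also have "\<dots> = (\<Sum>k\<in>UNIV. \<Sum>l\<in>UNIV. \<Sum>i\<in>UNIV. \<Sum>j\<in>UNIV. f k l i j)"
      by (intro sum.cong refl sum.swap)
    finally show ?thesis .
  qed
  have "casimir (lie_symbol \<delta>) P x \<xi>
    = (\<Sum>i\<in>UNIV. \<Sum>j\<in>UNIV. ?W i j j i) + (\<Sum>i\<in>UNIV. \<Sum>j\<in>UNIV. ?W i i j j)
      + 2 * (?n + 1) * (1 - \<delta>) * E + ?n * (?n + 1) * \<delta> * (\<delta> - 1) * P x \<xi>"
    unfolding casimir_lie_symbol_gl[OF P] plus_fun_apply sum_fun_apply 1 2 tr
    by (simp add: algebra_simps)
  also have "\<dots> = C_t \<delta> P x \<xi>"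
    unfolding C_t_def Let_def E reorder by simp
  finally show "casimir (lie_symbol \<delta>) P x \<xi> = C_t \<delta> P x \<xi>" .
qed

section \<open>Lie derivatives of multidifferential operators\<close>

lemma smooth_divergence: "(\<And>i. smooth (\<lambda>y. X y $ i)) \<Longrightarrow> smooth (divergence X)"
  unfolding divergence_def[abs_def] by (intro smooth_sum smooth_partial)

lemma slot_slot:
  assumes "\<forall>l. smooth (f l)" "smooth (\<Phi> (f k))"
  shows "slot k \<Phi> (slot k \<Psi> T) f = T (f(k := \<Psi> (\<Phi> (f k))))"
proof -
  have "\<forall>l. smooth ((f(k := \<Phi> (f k))) l)" using assms by simp
  then show ?thesis using assms unfolding slot_def by simp
qed

text \<open>
  All operations on the right-hand side have known effect on polynomial forms, as soon as the components
  and the divergence of \<open>X\<close> are polynomials.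
\<close>

lemma lie_op_decomp:
  assumes T: "has_symbol T P" and X: "\<And>i. smooth (\<lambda>y. X y $ i)"
  shows "lie_op lam \<mu> X T = (\<Sum>i\<in>UNIV. (\<lambda>f x. X x $ i * partial i (T f) x))
    + (\<lambda>f x. (\<mu> * divergence X x) * T f x)
    - (\<Sum>k\<in>UNIV. (\<Sum>i\<in>UNIV. slot k (partial i) (slot k (\<lambda>f y. X y $ i * f y) T))
        + (\<lambda>f x. lam $ k * slot k (\<lambda>f y. divergence X y * f y) T f x))"
proof (intro ext)
  fix f x
  show "lie_op lam \<mu> X T f x = ((\<Sum>i\<in>UNIV. (\<lambda>f x. X x $ i * partial i (T f) x))
    + (\<lambda>f x. (\<mu> * divergence X x) * T f x)
    - (\<Sum>k\<in>UNIV. (\<Sum>i\<in>UNIV. slot k (partial i) (slot k (\<lambda>f y. X y $ i * f y) T))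
        + (\<lambda>f x. lam $ k * slot k (\<lambda>f y. divergence X y * f y) T f x))) f x"
  proof (cases "\<forall>l. smooth (f l)")
    case True
    have sX: "smooth (\<lambda>y. X y $ i * partial i (f k) y)" for i k
      using X True by (intro smooth_mult smooth_partial) auto
    have sd: "smooth (\<lambda>y. divergence X y * f k y)" for k
      using True smooth_divergence[of X, OF X] by (intro smooth_mult) auto
    have "T (f(k := lie_density w X (f k))) x
      = (\<Sum>i\<in>UNIV. T (f(k := (\<lambda>y. X y $ i * partial i (f k) y))) x)
        + w * T (f(k := (\<lambda>y. divergence X y * f k y))) x" for k w
    proof -
      have "lie_density w X (f k) = (\<lambda>y. (\<Sum>i\<in>UNIV. X y $ i * partial i (f k) y) + w * (divergence X y * f k y))"
        by (simp add: fun_eq_iff lie_density_def)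
      then show ?thesis
        by (simp only: has_symbol_upd_add[OF T True smooth_sum[OF sX] smooth_mult[OF smooth_const sd]]
            has_symbol_upd_sum[OF T True sX] has_symbol_upd_cmult[OF T True sd])
    qed
    moreover have "slot k (partial i) (slot k (\<lambda>f y. X y $ i * f y) T) f
        = T (f(k := (\<lambda>y. X y $ i * partial i (f k) y)))" for k i
      using True by (simp add: slot_slot smooth_partial)
    moreover have "slot k (\<lambda>f y. divergence X y * f y) T f = T (f(k := (\<lambda>y. divergence X y * f k y)))" for k
      using True by (simp add: slot_def)
    ultimately show ?thesis
      unfolding lie_op_def using True
      by (simp add: sum_fun_apply lie_density_def)
  next
    case False
    have "T f = 0" by (rule has_symbol_nonsmooth[OF T False])
    with False show ?thesis
      by (simp only: lie_op_def slot_def if_False sum_fun_apply plus_fun_apply minus_apply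
          partial_zero zero_fun_apply mult_zero_right sum.neutral_const add_0 diff_zero)
  qed
qed

text \<open>
  \<open>Q\<close> and \<open>R\<close> collect the corrections that arise when derivatives in the \<open>k\<close>-th argument hit the components and
  the divergence of \<open>X\<close>.  Without them, the terms \<open>X\<^sup>i \<xi>\<^sup>k\<^sub>i\<close> from \<open>L\<^sub>X \<circ> T\<close> and from the arguments cancel, and the weights
  combine to \<open>\<mu> - \<Sum> \<lambda>\<^sub>k\<close>.
\<close>

lemma has_symbol_lie_op:
  assumes T: "has_symbol T P" and X: "\<And>i. smooth (\<lambda>y. X y $ i)"
    and Q: "\<And>k i. has_symbol (slot k (\<lambda>f y. X y $ i * f y) T) (\<lambda>x \<xi>. X x $ i * P x \<xi> + Q k i x \<xi>)"
    and R: "\<And>k. has_symbol (slot k (\<lambda>f y. divergence X y * f y) T) (\<lambda>x \<xi>. divergence X x * P x \<xi> + R k x \<xi>)"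
  shows "has_symbol (lie_op lam \<mu> X T) (\<lambda>x \<xi>. (\<Sum>i\<in>UNIV. X x $ i * dx i P x \<xi>)
    + (\<mu> - (\<Sum>k\<in>UNIV. lam $ k)) * divergence X x * P x \<xi>
    - (\<Sum>k\<in>UNIV. (\<Sum>i\<in>UNIV. \<xi> $ k $ i * Q k i x \<xi>) + lam $ k * R k x \<xi>))"
proof -
  have d: "smooth (\<lambda>x. \<mu> * divergence X x)"
    by (intro smooth_mult smooth_const smooth_divergence X)
  have "has_symbol (lie_op lam \<mu> X T)
     ((\<Sum>i\<in>UNIV. (\<lambda>x \<xi>. X x $ i * (dx i P + (\<Sum>k\<in>UNIV. (\<lambda>x \<xi>. \<xi> $ k $ i * P x \<xi>))) x \<xi>))
    + (\<lambda>x \<xi>. (\<mu> * divergence X x) * P x \<xi>)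
    - (\<Sum>k\<in>UNIV. (\<Sum>i\<in>UNIV. (\<lambda>x \<xi>. \<xi> $ k $ i * (X x $ i * P x \<xi> + Q k i x \<xi>)))
        + (\<lambda>x \<xi>. lam $ k * (divergence X x * P x \<xi> + R k x \<xi>))))"
    unfolding lie_op_decomp[OF T X]
    by (intro has_symbol_diff has_symbol.add has_symbol_sum has_symbol_mult[OF X has_symbol_partial[OF T]]
        has_symbol_mult[OF d T] has_symbol_slot_partial[OF Q] has_symbol_cmult[OF R])
  then show ?thesis
  proof (rule has_symbol_cong, goal_cases)
    case 2
    show ?case
    proof (intro ext)
      fix x \<xi>
      have "(\<Sum>i\<in>UNIV. X x $ i * (\<Sum>k\<in>UNIV. \<xi> $ k $ i * P x \<xi>))
        = (\<Sum>k\<in>UNIV. \<Sum>i\<in>UNIV. \<xi> $ k $ i * (X x $ i * P x \<xi>))"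
        by (subst sum.swap) (simp add: sum_distrib_left mult_ac)
      then show "((\<Sum>i\<in>UNIV. (\<lambda>x \<xi>. X x $ i * (dx i P + (\<Sum>k\<in>UNIV. (\<lambda>x \<xi>. \<xi> $ k $ i * P x \<xi>))) x \<xi>))
          + (\<lambda>x \<xi>. (\<mu> * divergence X x) * P x \<xi>)
          - (\<Sum>k\<in>UNIV. (\<Sum>i\<in>UNIV. (\<lambda>x \<xi>. \<xi> $ k $ i * (X x $ i * P x \<xi> + Q k i x \<xi>)))
          + (\<lambda>x \<xi>. lam $ k * (divergence X x * P x \<xi> + R k x \<xi>)))) x \<xi>
        = (\<Sum>i\<in>UNIV. X x $ i * dx i P x \<xi>) + (\<mu> - (\<Sum>k\<in>UNIV. lam $ k)) * divergence X x * P x \<xi>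
          - (\<Sum>k\<in>UNIV. (\<Sum>i\<in>UNIV. \<xi> $ k $ i * Q k i x \<xi>) + lam $ k * R k x \<xi>)"
        by (simp add: sum_fun_apply distrib_left sum.distrib left_diff_distrib sum_distrib_right mult.assoc)
    qed
  qed simp
qed

lemma has_symbol_slot_affine:
  assumes T: "has_symbol T P"
  shows "has_symbol (slot k (\<lambda>f y. (c + (\<Sum>b\<in>UNIV. m b * y $ b)) * f y) T)
    (\<lambda>x \<xi>. (c + (\<Sum>b\<in>UNIV. m b * x $ b)) * P x \<xi> + (\<Sum>b\<in>UNIV. m b * D_xi k b P x \<xi>))"
proof -
  have "has_symbol ((\<lambda>f x. c * T f x) + (\<Sum>b\<in>UNIV. (\<lambda>f x. m b * slot k (\<lambda>f y. y $ b * f y) T f x)))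
    ((\<lambda>x \<xi>. c * P x \<xi>) + (\<Sum>b\<in>UNIV. (\<lambda>x \<xi>. m b * (x $ b * P x \<xi> + D_xi k b P x \<xi>))))"
    by (intro has_symbol.add has_symbol_sum has_symbol_cmult has_symbol_slot_coord T)
  moreover have "(\<lambda>f x. c * T f x) + (\<Sum>b\<in>UNIV. (\<lambda>f x. m b * slot k (\<lambda>f y. y $ b * f y) T f x))
    = slot k (\<lambda>f y. (c + (\<Sum>b\<in>UNIV. m b * y $ b)) * f y) T"
  proof (intro ext)
    fix f x
    show "((\<lambda>f x. c * T f x) + (\<Sum>b\<in>UNIV. (\<lambda>f x. m b * slot k (\<lambda>f y. y $ b * f y) T f x))) f x
      = slot k (\<lambda>f y. (c + (\<Sum>b\<in>UNIV. m b * y $ b)) * f y) T f x"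
    proof (cases "\<forall>l. smooth (f l)")
      case True
      then have f: "smooth (f k)" by blast
      have b: "smooth (\<lambda>y. y $ b * f k y)" for b by (intro smooth_mult smooth_coord f)
      have mb: "smooth (\<lambda>y. m b * (y $ b * f k y))" for b by (intro smooth_mult smooth_coord smooth_const f)
      have "(\<lambda>y. (c + (\<Sum>b\<in>UNIV. m b * y $ b)) * f k y)
        = (\<lambda>y. c * f k y + (\<Sum>b\<in>UNIV. m b * (y $ b * f k y)))"
        by (simp add: fun_eq_iff distrib_right sum_distrib_right mult.assoc)
      then have "T (f(k := (\<lambda>y. (c + (\<Sum>b\<in>UNIV. m b * y $ b)) * f k y))) x
        = c * T (f(k := f k)) x + (\<Sum>b\<in>UNIV. m b * T (f(k := (\<lambda>y. y $ b * f k y))) x)"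
        by (simp only: has_symbol_upd_add[OF T True smooth_mult[OF smooth_const f] smooth_sum[OF mb]]
            has_symbol_upd_sum[OF T True mb] has_symbol_upd_cmult[OF T True b]
            has_symbol_upd_cmult[OF T True f])
      with True show ?thesis by (simp add: slot_def sum_fun_apply)
    next
      case False
      with has_symbol_nonsmooth[OF T False] show ?thesis
        by (simp only: slot_def if_False sum_fun_apply plus_fun_apply zero_fun_apply mult_zero_right
            sum.neutral_const add_0)
    qed
  qed
  moreover have "(\<lambda>x \<xi>. c * P x \<xi>) + (\<Sum>b\<in>UNIV. (\<lambda>x \<xi>. m b * (x $ b * P x \<xi> + D_xi k b P x \<xi>)))
    = (\<lambda>x \<xi>. (c + (\<Sum>b\<in>UNIV. m b * x $ b)) * P x \<xi> + (\<Sum>b\<in>UNIV. m b * D_xi k b P x \<xi>))"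
    by (simp add: fun_eq_iff sum_fun_apply distrib_right distrib_left sum.distrib sum_distrib_right mult.assoc)
  ultimately show ?thesis by (rule has_symbol_cong)
qed

lemma smooth_affine_field: "smooth (\<lambda>y. affine_field m c y $ i)"
  unfolding affine_field_def by (simp, intro smooth_intros smooth_const smooth_coord)

text \<open>
  For affine fields the corrections are of first order in \<open>D_xi\<close> and give exactly the Jacobian term of
  \<open>lie_symbol\<close>: operators and symbols are isomorphic as modules over affine vector fields.
\<close>

lemma has_symbol_lie_op_affine:
  assumes T: "has_symbol T P" and \<delta>: "\<delta> = \<mu> - (\<Sum>k\<in>UNIV. lam $ k)"
  shows "has_symbol (lie_op lam \<mu> (affine_field m c) T) (lie_symbol \<delta> (affine_field m c) P)"
proof -
  have "has_symbol (lie_op lam \<mu> (affine_field m c) T) (\<lambda>x \<xi>.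
    (\<Sum>i\<in>UNIV. affine_field m c x $ i * dx i P x \<xi>)
    + (\<mu> - (\<Sum>k\<in>UNIV. lam $ k)) * divergence (affine_field m c) x * P x \<xi>
    - (\<Sum>k\<in>UNIV. (\<Sum>i\<in>UNIV. \<xi> $ k $ i * (\<Sum>b\<in>UNIV. m i b * D_xi k b P x \<xi>)) + lam $ k * 0))"
  proof (rule has_symbol_lie_op[OF T smooth_affine_field])
    fix k i
    show "has_symbol (slot k (\<lambda>f y. affine_field m c y $ i * f y) T)
      (\<lambda>x \<xi>. affine_field m c x $ i * P x \<xi> + (\<Sum>b\<in>UNIV. m i b * D_xi k b P x \<xi>))"
      using has_symbol_slot_affine[OF T, of k "c i" "m i"] by (simp add: affine_field_def)
    show "has_symbol (slot k (\<lambda>f y. divergence (affine_field m c) y * f y) T)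
      (\<lambda>x \<xi>. divergence (affine_field m c) x * P x \<xi> + 0)"
      using has_symbol_slot_affine[OF T, of k "\<Sum>a\<in>UNIV. m a a" "\<lambda>_. 0"] by (simp add: divergence_affine_field)
  qed
  then show ?thesis
    by (rule has_symbol_cong) (simp_all add: fun_eq_iff lie_symbol_def partial_affine_field dx_def
        sum_distrib_left \<delta> mult_ac)
qed

text \<open>
  The operator \<open>\<Sum>\<^sub>k (E\<^bsub>\<xi>\<^sup>k\<^esub> + (n + 1) \<lambda>\<^sub>k) D\<^bsub>\<xi>\<^sup>k\<^sub>i\<^esub>\<close>, which measures how far the polynomial form is from commuting
  with \<open>L\<close> along \<open>\<epsilon>\<^sup>i\<close>.
\<close>

definition eps_defect :: "real^'p::finite \<Rightarrow> 'n::finite \<Rightarrow> ('n, 'p) symb \<Rightarrow> ('n, 'p) symb" where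
  "eps_defect lam i P x \<xi> =
    (\<Sum>k\<in>UNIV. euler_xi k (D_xi k i P) x \<xi> + (real CARD('n) + 1) * lam $ k * D_xi k i P x \<xi>)"

lemma smooth_eps_vec: "smooth (\<lambda>y. eps_vec i y $ a)"
  by (simp add: eps_vec_def smooth_mult)

text \<open>
  The components \<open>x\<^sup>i x\<^sup>a\<close> are quadratic, so \<open>(x\<^sup>a + D\<^sub>a) (x\<^sup>i + D\<^sub>i)\<close> leaves the second-order term \<open>D\<^sub>a D\<^sub>i\<close>,
  whose contraction with \<open>\<xi>\<^sub>a\<close> is \<open>E D\<^sub>i\<close>.  The divergence \<open>(n + 1) x\<^sup>i\<close> adds \<open>(n + 1) D\<^sub>i\<close> with the
  weight of the argument.
\<close>

lemma has_symbol_lie_op_eps_vec: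
  fixes T :: "('n::finite, 'p::finite) multiop"
  assumes T: "has_symbol T P" and \<delta>: "\<delta> = \<mu> - (\<Sum>k\<in>UNIV. lam $ k)"
  shows "has_symbol (lie_op lam \<mu> (eps_vec i) T) (lie_symbol \<delta> (eps_vec i) P - eps_defect lam i P)"
proof -
  have P: "P \<in> symbols" using T unfolding symbols_iff by blast
  let ?n = "real CARD('n)"
  have "has_symbol (lie_op lam \<mu> (eps_vec i) T) (\<lambda>x \<xi>.
    (\<Sum>a\<in>UNIV. eps_vec i x $ a * dx a P x \<xi>)
    + (\<mu> - (\<Sum>k\<in>UNIV. lam $ k)) * divergence (eps_vec i) x * P x \<xi>
    - (\<Sum>k\<in>UNIV. (\<Sum>a\<in>UNIV. \<xi> $ k $ a *
          (x $ a * D_xi k i P x \<xi> + x $ i * D_xi k a P x \<xi> + D_xi k a (D_xi k i P) x \<xi>))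
        + lam $ k * ((?n + 1) * D_xi k i P x \<xi>)))"
  proof (rule has_symbol_lie_op[OF T smooth_eps_vec])
    fix k a
    have "slot k (\<lambda>f y. eps_vec i y $ a * f y) T
      = slot k (\<lambda>f y. y $ a * f y) (slot k (\<lambda>f y. y $ i * f y) T)"
    proof
      fix f :: "'p \<Rightarrow> real^'n \<Rightarrow> real"
      show "slot k (\<lambda>f y. eps_vec i y $ a * f y) T f
        = slot k (\<lambda>f y. y $ a * f y) (slot k (\<lambda>f y. y $ i * f y) T) f"
      proof (cases "\<forall>l. smooth (f l)")
        case True
        then have "smooth (\<lambda>y. y $ a * f k y)" by (intro smooth_mult smooth_coord) blast
        then show ?thesis
          using True by (subst slot_slot) (simp_all add: slot_def eps_vec_def mult.assoc)
      qed (simp only: slot_def if_False)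
    qed
    moreover have "x $ a * (x $ i * P x \<xi> + D_xi k i P x \<xi>) + D_xi k a (\<lambda>x \<xi>. x $ i * P x \<xi> + D_xi k i P x \<xi>) x \<xi>
      = eps_vec i x $ a * P x \<xi> + (x $ a * D_xi k i P x \<xi> + x $ i * D_xi k a P x \<xi> + D_xi k a (D_xi k i P) x \<xi>)"
      for x \<xi>
    proof -
      have "D_xi k a ((\<lambda>x \<xi>. x $ i * P x \<xi>) + D_xi k i P) x \<xi>
        = x $ i * D_xi k a P x \<xi> + D_xi k a (D_xi k i P) x \<xi>"
        by (subst D_xi_add) (simp_all add: symbols_intros P D_xi_mult)
      then show ?thesis by (simp add: plus_fun_def eps_vec_def algebra_simps)
    qed
    ultimately show "has_symbol (slot k (\<lambda>f y. eps_vec i y $ a * f y) T)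
      (\<lambda>x \<xi>. eps_vec i x $ a * P x \<xi>
        + (x $ a * D_xi k i P x \<xi> + x $ i * D_xi k a P x \<xi> + D_xi k a (D_xi k i P) x \<xi>))"
      using has_symbol_slot_coord[OF has_symbol_slot_coord[OF T, of k i], of k a] by (simp only:)
    show "has_symbol (slot k (\<lambda>f y. divergence (eps_vec i) y * f y) T)
      (\<lambda>x \<xi>. divergence (eps_vec i) x * P x \<xi> + (?n + 1) * D_xi k i P x \<xi>)"
      using has_symbol_slot_affine[OF T, of k 0 "\<lambda>b. if b = i then ?n + 1 else 0"]
      by (simp add: divergence_eps_vec if_distrib[where f = "\<lambda>t. t * _"] cong: if_cong)
  qed
  then show ?thesis
  proof (rule has_symbol_cong)
    have "(\<Sum>b\<in>UNIV. partial b (\<lambda>y. eps_vec i y $ a) x * \<xi> $ k $ a * D_xi k b P x \<xi>)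
      = \<xi> $ k $ a * (x $ a * D_xi k i P x \<xi> + x $ i * D_xi k a P x \<xi>)" for a k x \<xi>
      by (simp add: partial_eps_vec mult.assoc distrib_right sum.distrib
          if_distrib[where f = "\<lambda>t. t * _"] cong: if_cong) (simp add: algebra_simps)
    then show "(\<lambda>x \<xi>. (\<Sum>a\<in>UNIV. eps_vec i x $ a * dx a P x \<xi>)
    + (\<mu> - (\<Sum>k\<in>UNIV. lam $ k)) * divergence (eps_vec i) x * P x \<xi>
    - (\<Sum>k\<in>UNIV. (\<Sum>a\<in>UNIV. \<xi> $ k $ a *
          (x $ a * D_xi k i P x \<xi> + x $ i * D_xi k a P x \<xi> + D_xi k a (D_xi k i P) x \<xi>))
        + lam $ k * ((?n + 1) * D_xi k i P x \<xi>))) = lie_symbol \<delta> (eps_vec i) P - eps_defect lam i P"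
      by (simp add: fun_eq_iff lie_symbol_def dx_def eps_defect_def euler_xi_def \<delta> distrib_left distrib_right
          sum.distrib mult_ac)
  qed simp
qed

section \<open>The Casimir operator on multidifferential operators\<close>

lemma symbols_euler: "P \<in> symbols \<Longrightarrow> euler_xi k P \<in> symbols"
proof -
  assume "P \<in> symbols"
  then have "(\<Sum>i\<in>UNIV. (\<lambda>x \<xi>. \<xi> $ k $ i * D_xi k i P x \<xi>)) \<in> symbols"
    by (intro symbols_intros)
  then show ?thesis by (simp add: euler_xi_def[abs_def] sum_fun_apply[abs_def])
qed

lemma eps_defect_uminus: "P \<in> symbols \<Longrightarrow> eps_defect lam i (- P) = - eps_defect lam i P"
  by (simp add: fun_eq_iff eps_defect_def euler_xi_def D_xi_rules(2) symbols_D_xi sum_negf sum.distrib sum_subtractf)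

lemma dx_euler:
  assumes P: "P \<in> symbols"
  shows "dx i (euler_xi k P) = euler_xi k (dx i P)"
proof -
  have "euler_xi k P = (\<Sum>j\<in>UNIV. (\<lambda>x \<xi>. \<xi> $ k $ j * D_xi k j P x \<xi>))"
    by (simp add: fun_eq_iff euler_xi_def sum_fun_apply)
  then have "dx i (euler_xi k P) = (\<Sum>j\<in>UNIV. dx i (\<lambda>x \<xi>. \<xi> $ k $ j * D_xi k j P x \<xi>))"
    by (simp only:) (intro dx_rules(4) symbols_intros P)
  then show ?thesis
    by (simp add: fun_eq_iff euler_xi_def sum_fun_apply dx_xi_mult symbols_D_xi P dx_D_xi)
qed

lemma eps_defect_eq:
  "eps_defect lam (i::'n::finite) P = (\<Sum>k\<in>UNIV. euler_xi k (D_xi k i P)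
    + (\<lambda>x \<xi>. ((real CARD('n) + 1) * lam $ k) * D_xi k i P x \<xi>))"
  by (simp add: fun_eq_iff eps_defect_def sum_fun_apply)

lemma symbols_eps_defect: "P \<in> symbols \<Longrightarrow> eps_defect lam i P \<in> symbols"
  unfolding eps_defect_eq by (intro symbols_intros symbols_euler)

lemma dx_eps_defect:
  assumes P: "P \<in> symbols"
  shows "dx i (eps_defect lam i P) = eps_defect lam i (dx i P)"
proof -
  have "dx i (eps_defect lam i P) = (\<Sum>k\<in>UNIV. dx i (euler_xi k (D_xi k i P)
    + (\<lambda>x \<xi>. ((real CARD('a) + 1) * lam $ k) * D_xi k i P x \<xi>)))"
    unfolding eps_defect_eq by (intro dx_rules(4) symbols_intros symbols_euler P)
  then show ?thesis
    by (simp add: fun_eq_iff eps_defect_def sum_fun_apply dx_add symbols_intros symbols_euler P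
        dx_euler dx_mult[OF smooth_const] dx_D_xi)
qed

text \<open>
  The two equal sums stem from the two occurrences of \<open>\<epsilon>\<^sup>i\<close> in the Casimir sum, once to the right and once
  to the left of \<open>e\<^sub>i = - \<partial>\<^sub>i\<close>.
\<close>

lemma N_C_eq:
  assumes P: "P \<in> symbols"
  shows "N_C lam P = (\<Sum>i\<in>UNIV. eps_defect lam i (dx i P)) + (\<Sum>i\<in>UNIV. eps_defect lam i (dx i P))"
proof (intro ext)
  fix x \<xi>
  have eta: "eta_D k P = (\<Sum>i\<in>UNIV. D_xi k i (dx i P))" for k
    by (simp add: fun_eq_iff eta_D_def sum_fun_apply flip: dx_D_xi[OF P]) (simp add: dx_def)
  have "euler_xi k (eta_D k P) x \<xi> = (\<Sum>i\<in>UNIV. euler_xi k (D_xi k i (dx i P)) x \<xi>)" for k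
  proof -
    have "D_xi k j (\<Sum>i\<in>UNIV. D_xi k i (dx i P)) = (\<Sum>i\<in>UNIV. D_xi k j (D_xi k i (dx i P)))" for j
      by (intro D_xi_rules(4) symbols_intros P)
    then show ?thesis
      unfolding eta euler_xi_def
      by (simp add: sum_fun_apply sum_distrib_left) (rule sum.swap)
  qed
  then have "N_C lam P x \<xi> = 2 * (\<Sum>k\<in>UNIV. \<Sum>i\<in>UNIV. euler_xi k (D_xi k i (dx i P)) x \<xi>
      + (real CARD('a) + 1) * lam $ k * D_xi k i (dx i P) x \<xi>)"
    by (simp add: N_C_def eta sum_fun_apply sum.distrib sum_distrib_left)
  also have "\<dots> = 2 * (\<Sum>i\<in>UNIV. eps_defect lam i (dx i P) x \<xi>)"
    unfolding eps_defect_def by (subst sum.swap) simp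
  finally show "N_C lam P x \<xi> = ((\<Sum>i\<in>UNIV. eps_defect lam i (dx i P)) + (\<Sum>i\<in>UNIV. eps_defect lam i (dx i P))) x \<xi>"
    by (simp add: sum_fun_apply)
qed

text \<open>
  Only the Lie derivatives along \<open>\<epsilon>\<^sup>i\<close> differ between operators and symbols, and each product in the Casimir sum
  contains at most one of them; so the difference is linear in \<open>eps_defect\<close>, which commutes with \<open>\<partial>\<^sub>i\<close>.
\<close>

lemma has_symbol_casimir:
  assumes T: "has_symbol T P" and \<delta>: "\<delta> = \<mu> - (\<Sum>k\<in>UNIV. lam $ k)"
  shows "has_symbol (casimir (lie_op lam \<mu>) T) (casimir (lie_symbol \<delta>) P + N_C lam P)"
proof -
  let ?L = "lie_symbol \<delta>" and ?K = "eps_defect lam"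
  have P: "P \<in> symbols" using T unfolding symbols_iff by blast
  have lin: "has_symbol (lie_op lam \<mu> X U) (?L X Q)" if "X = affine_field m c" "has_symbol U Q" for X U Q m c
    using has_symbol_lie_op_affine[OF that(2) \<delta>] that(1) by simp
  have eps: "has_symbol (lie_op lam \<mu> (eps_vec i) U) (?L (eps_vec i) Q - ?K i Q)" if "has_symbol U Q" for U Q i
    by (rule has_symbol_lie_op_eps_vec[OF that \<delta>])
  have off: "has_symbol (lie_op lam \<mu> (e_mat i j) (lie_op lam \<mu> (e_mat_dual i j) T))
      (?L (e_mat i j) (?L (e_mat_dual i j) P))" if "i \<noteq> j" for i j
    using that T by (simp add: e_mat_dual_def lin[OF e_mat_affine(1)])
  have "has_symbol (casimir (lie_op lam \<mu>) T)
    ((\<Sum>(i, j)\<in>{(i, j). i \<noteq> j}. ?L (e_mat i j) (?L (e_mat_dual i j) P))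
      + (\<Sum>i\<in>UNIV. ?L (e_mat i i) (?L (e_mat_dual i i) P)
        + ?L (e_vec i) (?L (eps_vec i) P - ?K i P)
        + (?L (eps_vec i) (?L (e_vec i) P) - ?K i (?L (e_vec i) P))))"
    unfolding casimir_def e_vec_dual_def eps_vec_dual_def
    by (intro has_symbol.add has_symbol_sum)
      (auto intro!: off lin[OF e_mat_affine(2)] lin[OF e_mat_affine(3)] lin[OF e_mat_affine(4)] eps T)
  moreover have 1: "?L (e_vec i) (?L (eps_vec i) P - ?K i P) = ?L (e_vec i) (?L (eps_vec i) P) + ?K i (dx i P)" for i
  proof -
    have "?L (eps_vec i) P \<in> symbols"
      unfolding lie_symbol_eps_vec by (intro symbols_intros symbols_x_mult symbols_gl_act P)
    then show ?thesis
      by (simp add: lie_symbol_e_vec dx_rules(3) symbols_eps_defect P dx_eps_defect)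
  qed
  moreover have 2: "?K i (?L (e_vec i) P) = - ?K i (dx i P)" for i
    by (simp add: lie_symbol_e_vec eps_defect_uminus symbols_dx P)
  ultimately show ?thesis
    unfolding casimir_def e_vec_dual_def eps_vec_dual_def N_C_eq[OF P]
    by (simp only: 1 2 sum.distrib diff_minus_eq_add add_ac)
qed

theorem proposition1:
  fixes lam :: "real^'p::finite" and \<mu> \<delta> :: real
  assumes "\<delta> = \<mu> - (\<Sum>k\<in>UNIV. lam $ k)"
  shows "(\<forall>T \<in> (multidiff_ops :: ('n::finite, 'p) multiop set).
            casimir (lie_op lam \<mu>) T \<in> multidiff_ops \<and>
            polynomial_form (casimir (lie_op lam \<mu>) T) =
              C_t \<delta> (polynomial_form T) + N_C lam (polynomial_form T))
       \<and> (\<forall>P \<in> (symbols :: ('n, 'p) symb set). casimir (lie_symbol \<delta>) P = C_t \<delta> P)"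
proof (intro conjI ballI)
  fix T :: "('n, 'p) multiop"
  assume "T \<in> multidiff_ops"
  then obtain P where T: "has_symbol T P" unfolding multidiff_ops_iff by blast
  then have P: "P \<in> symbols" unfolding symbols_iff by blast
  from has_symbol_casimir[OF T assms]
  have C: "has_symbol (casimir (lie_op lam \<mu>) T) (C_t \<delta> P + N_C lam P)"
    by (simp only: casimir_lie_symbol[OF P])
  show "casimir (lie_op lam \<mu>) T \<in> multidiff_ops"
    unfolding multidiff_ops_iff using C by blast
  show "polynomial_form (casimir (lie_op lam \<mu>) T)
      = C_t \<delta> (polynomial_form T) + N_C lam (polynomial_form T)"
    unfolding polynomial_form_eq[OF C] polynomial_form_eq[OF T] ..
qed (rule casimir_lie_symbol)

end
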